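(* Fix probabilities $p_1,p_2,p_3>0$ with $p_1+p_2+p_3=1$. Let $U_1,U_2,U_3$ be independent Haar-random unitaries on $\mathbb{C}^2\otimes\mathbb{C}^2$ and set $|\psi_i\rangle=U_i|00\rangle$. Then with probability one, no LOCC measurement attains the optimal minimum-error success probability for the ensemble $\{|\psi_i\rangle,p_i\}_{i=1}^3$.
   Context: The optimal minimum-error success probability of an ensemble $\{|\psi_i\rangle,p_i\}_{i=1}^n$ is the maximum over all $n$-outcome POVMs $\{\Pi_i\}$ of $\sum_ip_i\langle\psi_i|\Pi_i|\psi_i\rangle$. LOCC means measurements implementable by local operations on each qubit and classical communication between the two parties. *)

theory Defs
  imports "HOL-Analysis.Analysis"
begin

text \<open>One qubit: C^2, indexed by the numeral type 2. Two qubits: C^2 (x) C^2 = C^(2 x 2).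
  Operators are matrices over these index types.\<close>

type_synonym qop = "complex^2^2"
type_synonym bvec = "complex^(2 \<times> 2)"
type_synonym bop = "complex^(2 \<times> 2)^(2 \<times> 2)"

definition madj :: "complex^'n^'m \<Rightarrow> complex^'m^'n" where
  "madj A = (\<chi> i j. cnj (A $ j $ i))"

definition unitary_op :: "bop \<Rightarrow> bool" where
  "unitary_op U \<longleftrightarrow> madj U ** U = mat 1"

definition tensor :: "qop \<Rightarrow> qop \<Rightarrow> bop" where
  "tensor A B = (\<chi> p q. A $ fst p $ fst q * B $ snd p $ snd q)"

definition ket00 :: bvec where
  "ket00 = (\<chi> p. if p = (0, 0) then 1 else 0)"

definition qform :: "bop \<Rightarrow> bvec \<Rightarrow> complex" where
  "qform A v = (\<Sum>k\<in>UNIV. cnj (v $ k) * ((A *v v) $ k))"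

definition psd :: "bop \<Rightarrow> bool" where
  "psd A \<longleftrightarrow> madj A = A \<and> (\<forall>v. 0 \<le> Re (qform A v))"

definition povm :: "nat \<Rightarrow> (nat \<Rightarrow> bop) \<Rightarrow> bool" where
  "povm n P \<longleftrightarrow> (\<forall>i<n. psd (P i)) \<and> (\<Sum>i<n. P i) = mat 1"

definition succ_prob :: "nat \<Rightarrow> (nat \<Rightarrow> real) \<Rightarrow> (nat \<Rightarrow> bvec) \<Rightarrow> (nat \<Rightarrow> bop) \<Rightarrow> real" where
  "succ_prob n p psi P = (\<Sum>i<n. p i * Re (qform (P i) (psi i)))"

definition opt_succ :: "nat \<Rightarrow> (nat \<Rightarrow> real) \<Rightarrow> (nat \<Rightarrow> bvec) \<Rightarrow> real" where
  "opt_succ n p psi = (SUP P \<in> {P. povm n P}. succ_prob n p psi P)"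

text \<open>Finite-round LOCC protocols. locc_from n K E: starting from the accumulated
  Kraus operator K (product of the Kraus operators applied so far), the remaining
  protocol realises the (partial) family E of POVM elements for outcomes 0..n-1.
  A step is either: stop and announce outcome i; or Alice (resp. Bob) performs a local
  measurement with Kraus operators A 0 .. A (m-1) (completeness sum A_k^dag A_k = 1)
  and, depending on the classical result k (communicated), the protocol continues.\<close>
inductive locc_from :: "nat \<Rightarrow> bop \<Rightarrow> (nat \<Rightarrow> bop) \<Rightarrow> bool" for n where
  stop: "i < n \<Longrightarrow> locc_from n K (\<lambda>j. if j = i then madj K ** K else 0)"
| alice: "(\<Sum>k<(m::nat). madj (A k) ** A k) = mat 1 \<Longrightarrow>
          (\<forall>k<m. locc_from n (tensor (A k) (mat 1) ** K) (E k)) \<Longrightarrow>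
          locc_from n K (\<lambda>j. \<Sum>k<m. E k j)"
| bob: "(\<Sum>k<(m::nat). madj (B k) ** B k) = mat 1 \<Longrightarrow>
          (\<forall>k<m. locc_from n (tensor (mat 1) (B k) ** K) (E k)) \<Longrightarrow>
          locc_from n K (\<lambda>j. \<Sum>k<m. E k j)"

definition locc_povm :: "nat \<Rightarrow> (nat \<Rightarrow> bop) \<Rightarrow> bool" where
  "locc_povm n P \<longleftrightarrow> locc_from n (mat 1) P"

text \<open>Haar probability measure on U(4), viewed as a Borel probability measure on the space
  of 4x4 complex matrices concentrated on the unitary group and invariant under left
  multiplication by unitaries (this determines it uniquely).\<close>
definition haar :: "bop measure \<Rightarrow> bool" where
  "haar M \<longleftrightarrow> emeasure M (space M) = 1 \<and> sets M = sets borel \<and>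
     emeasure M {U. unitary_op U} = 1 \<and>
     (\<forall>V. unitary_op V \<longrightarrow> (\<forall>A \<in> sets borel.
        emeasure M ((\<lambda>U. V ** U) -` A) = emeasure M A))"

definition ensemble :: "bop \<Rightarrow> bop \<Rightarrow> bop \<Rightarrow> nat \<Rightarrow> bvec" where
  "ensemble U1 U2 U3 i = (if i = 0 then U1 else if i = 1 then U2 else U3) *v ket00"

end

theory Submission
  imports Defs
begin

text \<open>Let \<open>\<eta> i = sqrt (p i) \<psi> i\<close>. For linearly independent states an optimal measurement
  \<open>\<Pi>\<close> satisfies \<open>\<Gamma> \<ge> |\<eta> j\<rangle>\<langle>\<eta> j|\<close> for the Hermitian part \<open>\<Gamma>\<close> of
  \<open>\<Sum>i. |\<eta> i\<rangle>\<langle>\<eta> i| \<Pi> i\<close>, and complementary slackness forces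
  \<open>\<Pi> i = |a i\<rangle>\<langle>a i| + q i |b\<rangle>\<langle>b|\<close>, where \<open>b\<close> spans the orthogonal complement of the
  states and the orthonormal vectors \<open>a 0\<close>, \<open>a 1\<close>, \<open>a 2\<close> are determined up to phases. The elements
  of an LOCC measurement are sums of projectors onto product vectors. If \<open>\<Pi> 0\<close> is such a sum, a
  real polynomial in \<open>a 0\<close> and \<open>b\<close> must vanish. The frame \<open>a, b\<close> moves along with the states
  under a common unitary \<open>V\<close>, which preserves their joint distribution, so it suffices that for
  fixed \<open>a, b\<close> the polynomial at \<open>V (a 0)\<close>, \<open>V b\<close> is nonzero for almost all \<open>V\<close>.\<close>

text \<open>Three states leave one dimension of C^4 free. The weights q i on \<open>b\<close> can be
  shared out at will without changing the success probability, so there is a whole family of optimal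
  measurements, and the obstruction has to exclude |a 0><a 0| + q |b><b| for every q at once;
  \<open>obstr\<close> does not mention q. Optimality determines \<open>a\<close> only implicitly.
  Fixing the triple and averaging over a common rotation V avoids any study of the map from states
  to frames: the frame is then constant and merely moved by V. Haar measure is given through its
  invariance, without coordinates on the group. Null sets are therefore obtained from Fubini along
  the curves 1 + i t S, which are unitary up to a real factor.\<close>

subsection \<open>The Hermitian inner product\<close>

definition cip :: "complex^'n \<Rightarrow> complex^'n \<Rightarrow> complex" where
  "cip x y = (\<Sum>k\<in>UNIV. cnj (x $ k) * y $ k)"

lemma cip_add_left: "cip (x + y) z = cip x z + cip y z"
  and cip_add_right: "cip x (y + z) = cip x y + cip x z"
  and cip_diff_left: "cip (x - y) z = cip x z - cip y z"
  and cip_diff_right: "cip x (y - z) = cip x y - cip x z"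
  and cip_scale_left: "cip (c *s x) y = cnj c * cip x y"
  and cip_scale_right: "cip x (c *s y) = c * cip x y"
  and cip_zero_left [simp]: "cip 0 y = 0"
  and cip_zero_right [simp]: "cip x 0 = 0"
  by (simp_all add: cip_def algebra_simps sum.distrib sum_subtractf sum_distrib_left)

lemmas cip_simps = cip_add_left cip_add_right cip_diff_left cip_diff_right
  cip_scale_left cip_scale_right

lemma cip_sum_right: "cip x (\<Sum>k\<in>A. f k) = (\<Sum>k\<in>A. cip x (f k))"
  by (induction A rule: infinite_finite_induct) (simp_all add: cip_add_right)

lemma cnj_cip [simp]: "cnj (cip x y) = cip y x"
  by (simp add: cip_def mult.commute)

lemma cmod_cip_commute: "cmod (cip x y) = cmod (cip y x)"
  by (metis cnj_cip complex_mod_cnj)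

lemma cip_commute_eq_0: "cip x y = 0 \<longleftrightarrow> cip y x = 0"
  by (metis cnj_cip complex_cnj_zero_iff)

lemma cip_self: "cip x x = of_real ((norm x)\<^sup>2)"
  unfolding cip_def norm_vec_def L2_set_def
  by (simp add: sum_nonneg complex_norm_square[symmetric] mult.commute[of "cnj _"])

lemma cip_self_eq_0 [simp]: "cip x x = 0 \<longleftrightarrow> x = 0"
  by (simp add: cip_self)

lemma cip_mult_swap: "cip x y * cip y x = of_real ((cmod (cip x y))\<^sup>2)"
  by (metis cnj_cip complex_norm_square)

lemma cip_ext: "(\<And>x. cip x y = cip x z) \<Longrightarrow> y = z"
  by (metis cip_diff_right cip_self_eq_0 eq_iff_diff_eq_0)

lemma norm_cscale: "norm (c *s x) = cmod c * norm (x :: complex^'n)"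
proof -
  have "complex_of_real ((norm (c *s x))\<^sup>2) = of_real ((cmod c * norm x)\<^sup>2)"
    unfolding cip_self[symmetric] cip_simps
    by (simp add: cip_self power_mult_distrib complex_norm_square[symmetric] mult.assoc[symmetric] mult.commute[of "cnj c"])
  then have "(norm (c *s x))\<^sup>2 = (cmod c * norm x)\<^sup>2"
    using of_real_eq_iff by blast
  then show ?thesis by simp
qed

lemma cip_adj: "cip x (A *v y) = cip (madj A *v x) y"
  unfolding cip_def madj_def matrix_vector_mult_def
  by (simp add: sum_distrib_left sum_distrib_right mult_ac) (subst sum.swap, simp)

lemma madj_madj [simp]: "madj (madj A) = A"
  by (simp add: madj_def vec_eq_iff)

lemma madj_mult: "madj (A ** B) = madj B ** madj A"
  by (simp add: madj_def matrix_matrix_mult_def vec_eq_iff mult.commute)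

lemma madj_one [simp]: "madj (mat 1 :: complex^'n^'n) = mat 1"
  by (auto simp: madj_def mat_def vec_eq_iff)

lemma unitary_cip:
  assumes "unitary_op V" shows "cip (V *v x) (V *v y) = cip x y"
  using assms by (simp add: cip_adj matrix_vector_mul_assoc unitary_op_def)

lemma unitary_norm:
  assumes "unitary_op V" shows "norm (V *v x) = norm x"
  using unitary_cip[OF assms, of x x] unfolding cip_self of_real_eq_iff by simp

lemma unitary_right_inverse: "unitary_op V \<Longrightarrow> V ** madj V = mat 1"
  unfolding unitary_op_def using matrix_left_right_inverse by blast

lemma unitary_madj: "unitary_op V \<Longrightarrow> unitary_op (madj V)"
  by (simp add: unitary_op_def unitary_right_inverse)

lemma UNIV_pair2: "(UNIV :: (2 \<times> 2) set) = {(0,0), (0,1), (1,0), (1,1)}"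
proof -
  have "(2::2) = 0" by simp
  then show ?thesis
    unfolding UNIV_Times_UNIV[symmetric] UNIV_2 by auto
qed

lemma sum_pair2:
  "(\<Sum>p\<in>(UNIV :: (2 \<times> 2) set). f p) = f (0,0) + f (0,1) + f (1,0) + f (1,1)"
  unfolding UNIV_pair2 by (simp add: add_ac)

lemma forall_pair2:
  "(\<forall>p :: 2 \<times> 2. P p) \<longleftrightarrow> P (0,0) \<and> P (0,1) \<and> P (1,0) \<and> P (1,1)"
  using UNIV_pair2 by (metis UNIV_I empty_iff insert_iff)

lemma sum_lessThan_4: "(\<Sum>i<(4::nat). f i) = f 0 + f 1 + f 2 + f 3"
  by (simp add: eval_nat_numeral)

lemma sum_lessThan_3: "(\<Sum>i<(3::nat). f i) = f 0 + f 1 + f 2"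
  by (simp add: eval_nat_numeral)

lemma less_3_cases: "(i::nat) < 3 \<longleftrightarrow> i = 0 \<or> i = 1 \<or> i = 2"
  by auto

lemma less_4_cases: "(i::nat) < 4 \<longleftrightarrow> i = 0 \<or> i = 1 \<or> i = 2 \<or> i = 3"
  by auto

text \<open>Three conjugated rows and a zero row make a singular matrix; a kernel vector is
  normalised.\<close>

lemma ex_unit_orthogonal:
  obtains x :: bvec where "norm x = 1" "cip a x = 0" "cip b x = 0" "cip c x = 0"
proof -
  define A :: bop where "A = (\<chi> p. if p = (0,0) then (\<chi> q. cnj (a $ q)) else
      if p = (0,1) then (\<chi> q. cnj (b $ q)) else if p = (1,0) then (\<chi> q. cnj (c $ q)) else 0)"
  have row: "(A *v x) $ (0,0) = cip a x" "(A *v x) $ (0,1) = cip b x" "(A *v x) $ (1,0) = cip c x" for x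
    by (simp_all add: A_def matrix_vector_mult_def cip_def)
  have "row (1,1) A = 0" by (simp add: row_def A_def vec_eq_iff)
  then have "det A = 0" by (rule det_zero_row)
  then have "\<not> invertible A" by (simp add: invertible_det_nz)
  then have "\<not> (\<exists>B. B ** A = mat 1)"
    unfolding invertible_def using matrix_left_right_inverse by blast
  then obtain x where x: "A *v x = 0" "x \<noteq> 0"
    using matrix_left_invertible_ker by blast
  define y where "y = complex_of_real (1 / norm x) *s x"
  have "A *v y = 0" using x by (simp add: y_def vector_scalar_commute)
  moreover have "norm y = 1" using x by (simp add: y_def norm_cscale norm_divide)
  ultimately show ?thesis using that row[of y] by simp
qed

lemma parseval:
  fixes a :: "nat \<Rightarrow> bvec"
  assumes "\<forall>i<4. \<forall>j<4. cip (a i) (a j) = (if i = j then 1 else 0)"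
  shows "(\<Sum>i<4. cip x (a i) * cip (a i) y) = cip x y"
proof -
  define n :: "2 \<times> 2 \<Rightarrow> nat" where
    "n p = (if p = (0,0) then 0 else if p = (0,1) then 1 else if p = (1,0) then 2 else 3)" for p
  define W :: bop where "W = (\<chi> p q. cnj (a (n p) $ q))"
  have W: "(W *v x) $ p = cip (a (n p)) x" for x p
    by (simp add: W_def matrix_vector_mult_def cip_def)
  have n: "n p < 4" "n p = n q \<longleftrightarrow> p = q" for p q
    using UNIV_I[of p] UNIV_I[of q] unfolding UNIV_pair2 by (auto simp: n_def)
  have "W ** madj W = mat 1"
  proof -
    have "(W ** madj W) $ p $ q = cip (a (n p)) (a (n q))" for p q
      by (simp add: W_def madj_def matrix_matrix_mult_def cip_def)
    then show ?thesis using assms n by (simp add: vec_eq_iff mat_def)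
  qed
  then have "madj W ** W = mat 1" using matrix_left_right_inverse by blast
  then have "cip x y = cip (W *v x) (W *v y)"
    by (simp add: cip_adj matrix_vector_mul_assoc)
  also have "\<dots> = (\<Sum>p\<in>UNIV. cip x (a (n p)) * cip (a (n p)) y)"
    by (simp add: cip_def[of "W *v x"] W)
  also have "\<dots> = (\<Sum>i<4. cip x (a i) * cip (a i) y)"
    by (simp add: sum_pair2 sum_lessThan_4 n_def)
  finally show ?thesis by simp
qed

subsection \<open>Rank-one measurements and their Lagrange operators\<close>

text \<open>A family of vectors \<open>w k\<close>, \<open>k < N\<close>, resolving the identity, where \<open>w k\<close> announces
  the outcome \<open>l k\<close>.\<close>

definition flat :: "nat \<Rightarrow> (nat \<Rightarrow> nat) \<Rightarrow> (nat \<Rightarrow> bvec) \<Rightarrow> bool" where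
  "flat N l w \<longleftrightarrow> (\<forall>k<N. l k < 3) \<and>
     (\<forall>x y. (\<Sum>k<N. cip x (w k) * cip (w k) y) = cip x y)"

text \<open>With the factors sqrt (p i) absorbed into \<eta>, this is the success probability; see
  \<open>succ_prob_flat_op\<close>.\<close>

definition gain :: "(nat \<Rightarrow> bvec) \<Rightarrow> nat \<Rightarrow> (nat \<Rightarrow> nat) \<Rightarrow> (nat \<Rightarrow> bvec) \<Rightarrow> real" where
  "gain \<eta> N l w = (\<Sum>k<N. (cmod (cip (\<eta> (l k)) (w k)))\<^sup>2)"

text \<open>The quadratic form of the Hermitian part of
  \<open>\<Gamma> = (\<Sum>i. |\<eta> i\<rangle>\<langle>\<eta> i| \<Pi> i)\<close>.\<close>

definition lag :: "(nat \<Rightarrow> bvec) \<Rightarrow> nat \<Rightarrow> (nat \<Rightarrow> nat) \<Rightarrow> (nat \<Rightarrow> bvec) \<Rightarrow> bvec \<Rightarrow> real" where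
  "lag \<eta> N l w x = Re (\<Sum>k<N. cip x (\<eta> (l k)) * cip (\<eta> (l k)) (w k) * cip (w k) x)"

text \<open>The constraint of the dual semidefinite program, whose objective is the trace of
  \<Gamma>.\<close>

definition dual_feasible :: "(nat \<Rightarrow> bvec) \<Rightarrow> nat \<Rightarrow> (nat \<Rightarrow> nat) \<Rightarrow> (nat \<Rightarrow> bvec) \<Rightarrow> bool" where
  "dual_feasible \<eta> N l w \<longleftrightarrow> (\<forall>j<3. \<forall>x. (cmod (cip (\<eta> j) x))\<^sup>2 \<le> lag \<eta> N l w x)"

text \<open>Linear independence of \<open>\<eta> 0\<close>, \<open>\<eta> 1\<close>, \<open>\<eta> 2\<close>, stated as one-dimensionality of the
  common orthogonal complement.\<close>

definition indep3 :: "(nat \<Rightarrow> bvec) \<Rightarrow> bool" where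
  "indep3 \<eta> \<longleftrightarrow> (\<forall>x y. (\<forall>i<3. cip (\<eta> i) x = 0 \<and> cip (\<eta> i) y = 0) \<and> cip x y = 0
     \<longrightarrow> x = 0 \<or> y = 0)"

lemma lag_scale: "lag \<eta> N l w (c *s x) = (cmod c)\<^sup>2 * lag \<eta> N l w x"
proof -
  have "(\<Sum>k<N. cip (c *s x) (\<eta> (l k)) * cip (\<eta> (l k)) (w k) * cip (w k) (c *s x)) =
      of_real ((cmod c)\<^sup>2) * (\<Sum>k<N. cip x (\<eta> (l k)) * cip (\<eta> (l k)) (w k) * cip (w k) x)"
    unfolding complex_norm_square cip_simps sum_distrib_left by (intro sum.cong) auto
  then show ?thesis unfolding lag_def by (simp del: of_real_power)
qed

text \<open>For a nonnegative quadratic form this law makes the zero set closed under addition; the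
  kernel arguments below use it in place of polarisation.\<close>

lemma lag_parallelogram:
  "lag \<eta> N l w (x + y) + lag \<eta> N l w (x - y) = 2 * lag \<eta> N l w x + 2 * lag \<eta> N l w y"
proof -
  have "lag \<eta> N l w (x + y) + lag \<eta> N l w (x - y) - 2 * lag \<eta> N l w x - 2 * lag \<eta> N l w y =
    (\<Sum>k<N. 0)"
    unfolding lag_def Re_sum sum.distrib[symmetric] sum_subtractf[symmetric] sum_distrib_left
    by (intro sum.cong) (simp_all add: cip_simps algebra_simps)
  then show ?thesis by simp
qed

lemma cip_parallelogram:
  "(cmod (cip z (x + y)))\<^sup>2 + (cmod (cip z (x - y)))\<^sup>2 = 2 * (cmod (cip z x))\<^sup>2 + 2 * (cmod (cip z y))\<^sup>2"
  unfolding cip_simps cmod_power2 by (simp add: power2_eq_square algebra_simps)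

text \<open>Each \<open>w k\<close> is damped by \<open>1 - e |x\<rangle>\<langle>x|\<close>, and the missing weight in direction \<open>x\<close> is given
  to outcome \<open>j\<close>. The first-order change of the gain bounds \<open>lag\<close> from below.\<close>

lemma flat_variation:
  assumes "flat N l w" "norm x = 1" "0 \<le> e" "e \<le> 2" "j < 3"
  shows "flat (Suc N) (l(N := j))
    ((\<lambda>k. w k - (of_real e * cip x (w k)) *s x)(N := of_real (sqrt (e * (2 - e))) *s x))"
    (is "flat _ ?l ?w")
proof -
  have "(\<Sum>k<Suc N. cip u (?w k) * cip (?w k) v) = cip u v" for u v
  proof -
    define A where "A u = u - (of_real e * cip x u) *s x" for u
    have sw: "cip u (A v) = cip (A u) v" for u v by (simp add: A_def cip_simps)
    have xx: "cip x x = 1" using assms by (simp add: cip_self)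
    have "(\<Sum>k<N. cip u (?w k) * cip (?w k) v) = (\<Sum>k<N. cip u (A (w k)) * cip (A (w k)) v)"
      by (intro sum.cong) (auto simp: A_def)
    also have "\<dots> = (\<Sum>k<N. cip (A u) (w k) * cip (w k) (A v))"
      by (simp add: sw)
    also have "\<dots> = cip (A u) (A v)" using assms by (simp add: flat_def)
    \<comment> \<open>(1 - e |x><x|)^2 = 1 - e (2 - e) |x><x| for a unit vector x; the appended
      vector, of squared length e (2 - e), fills this defect.\<close>
    also have "\<dots> = cip u v - of_real (e * (2 - e)) * cip u x * cip x v"
      by (simp add: A_def cip_simps xx algebra_simps)
    finally have 1: "(\<Sum>k<N. cip u (?w k) * cip (?w k) v) = \<dots>" .
    have "complex_of_real (sqrt (e * (2 - e))) * complex_of_real (sqrt (e * (2 - e))) = of_real (e * (2 - e))"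
      using assms by (simp flip: of_real_mult)
    then have 2: "cip u (?w N) * cip (?w N) v = of_real (e * (2 - e)) * cip u x * cip x v"
      by (simp add: cip_simps del: of_real_mult)
    show ?thesis unfolding sum.lessThan_Suc 1 2 by simp
  qed
  moreover have "?l k < 3" if "k < Suc N" for k using assms that by (auto simp: flat_def)
  ultimately show ?thesis unfolding flat_def by blast
qed

lemma dual_feasible_unit:
  assumes "flat N l w" "j < 3" "norm x = 1"
    and opt: "\<And>N' l' w'. flat N' l' w' \<Longrightarrow> gain \<eta> N' l' w' \<le> gain \<eta> N l w"
  shows "(cmod (cip (\<eta> j) x))\<^sup>2 \<le> lag \<eta> N l w x"
proof -
  define h where "h = (cmod (cip (\<eta> j) x))\<^sup>2"
  define D where "D = (\<Sum>k<N. (cmod (cip x (w k) * cip (\<eta> (l k)) x))\<^sup>2)"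
  define L where "L = lag \<eta> N l w x"
  \<comment> \<open>The variation changes the gain by 2 e (h - L) - e^2 (h - D). Optimality forbids
    an increase, and e is divided out.\<close>
  have var: "2 * (h - L) \<le> e * (h - D)" if e: "0 < e" "e \<le> 2" for e
  proof -
    define w' where "w' = (\<lambda>k. w k - (of_real e * cip x (w k)) *s x)(N := of_real (sqrt (e * (2 - e))) *s x)"
    have "gain \<eta> (Suc N) (l(N := j)) w' \<le> gain \<eta> N l w"
      unfolding w'_def by (intro opt flat_variation) (use assms e in auto)
    moreover have "gain \<eta> (Suc N) (l(N := j)) w' =
      (\<Sum>k<N. (cmod (cip (\<eta> (l k)) (w k) - e * (cip x (w k) * cip (\<eta> (l k)) x)))\<^sup>2) + e * (2 - e) * h"
      unfolding gain_def using e
      by (simp add: w'_def cip_simps norm_mult power_mult_distrib h_def mult.assoc)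
    moreover have "(\<Sum>k<N. (cmod (cip (\<eta> (l k)) (w k) - e * (cip x (w k) * cip (\<eta> (l k)) x)))\<^sup>2)
      = gain \<eta> N l w - 2 * e * L + e\<^sup>2 * D"
    proof -
      have "(cmod (a - e * (b * c)))\<^sup>2 = (cmod a)\<^sup>2 - 2 * e * Re (cnj c * a * cnj b) + e\<^sup>2 * (cmod (b * c))\<^sup>2" for a b c :: complex
        unfolding cmod_power2 by (simp add: power2_eq_square algebra_simps)
      then show ?thesis
        unfolding gain_def L_def lag_def D_def Re_sum
        by (simp only: cnj_cip sum.distrib sum_subtractf sum_distrib_left)
    qed
    ultimately have "e * (2 * (h - L)) \<le> e * (e * (h - D))"
      by (simp add: algebra_simps power2_eq_square)
    then show ?thesis using e by simp
  qed
  have "h \<le> L"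
  proof (rule ccontr)
    assume "\<not> h \<le> L"
    then have pos: "h - L > 0" by simp
    \<comment> \<open>Chosen so that e (h - D) \<le> h - L < 2 (h - L), against \<open>var\<close>;
      the summand 1 keeps the denominator positive.\<close>
    define e where "e = min 1 ((h - L) / (\<bar>h - D\<bar> + 1))"
    have e: "0 < e" "e \<le> 2" using pos by (auto simp: e_def)
    have "e * (h - D) \<le> e * (\<bar>h - D\<bar> + 1)" using e by (intro mult_left_mono) auto
    also have "\<dots> \<le> (h - L) / (\<bar>h - D\<bar> + 1) * (\<bar>h - D\<bar> + 1)"
      by (intro mult_right_mono) (auto simp: e_def)
    also have "\<dots> = h - L" by (simp add: nonzero_eq_divide_eq)
    finally show False using var[OF e] pos by simp
  qed
  then show ?thesis by (simp add: h_def L_def)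
qed

lemma dual_feasible_optimal:
  assumes "flat N l w"
    and "\<And>N' l' w'. flat N' l' w' \<Longrightarrow> gain \<eta> N' l' w' \<le> gain \<eta> N l w"
  shows "dual_feasible \<eta> N l w"
  unfolding dual_feasible_def
proof (intro allI impI)
  fix j :: nat and x assume j: "j < 3"
  show "(cmod (cip (\<eta> j) x))\<^sup>2 \<le> lag \<eta> N l w x"
  proof (cases "x = 0")
    case False
    define u where "u = of_real (1 / norm x) *s x"
    have u: "norm u = 1" using False by (simp add: u_def norm_cscale norm_divide)
    have x: "x = of_real (norm x) *s u" using False by (simp add: u_def)
    have "(norm x)\<^sup>2 * (cmod (cip (\<eta> j) u))\<^sup>2 \<le> (norm x)\<^sup>2 * lag \<eta> N l w u"
      using dual_feasible_unit[OF assms(1) j u assms(2)] by (intro mult_left_mono) auto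
    then show ?thesis
      by (subst (1 2) x) (simp add: lag_scale cip_simps norm_mult power_mult_distrib)
  qed (simp add: lag_def)
qed

text \<open>The left side is the trace of \<Gamma>, which is the same in every resolution of the
  identity.\<close>

lemma sum_lag:
  assumes "flat N l w" "flat N' l' w'"
  shows "(\<Sum>m<N'. lag \<eta> N l w (w' m)) = gain \<eta> N l w"
proof -
  have "(\<Sum>m<N'. \<Sum>k<N. cip (w' m) (\<eta> (l k)) * cip (\<eta> (l k)) (w k) * cip (w k) (w' m)) =
    (\<Sum>k<N. cip (\<eta> (l k)) (w k) * (\<Sum>m<N'. cip (w k) (w' m) * cip (w' m) (\<eta> (l k))))"
    by (subst sum.swap) (simp add: sum_distrib_left mult_ac)
  also have "\<dots> = (\<Sum>k<N. cip (\<eta> (l k)) (w k) * cip (w k) (\<eta> (l k)))"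
    using assms(2) by (simp add: flat_def)
  also have "\<dots> = of_real (gain \<eta> N l w)"
    by (simp add: cip_mult_swap gain_def)
  finally show ?thesis unfolding lag_def Re_sum[symmetric] by simp
qed

text \<open>The gaps are nonnegative by dual feasibility, and they sum to the trace of \<Gamma>
  minus the gain of \<open>w'\<close>, which is at most 0.\<close>

lemma slackness:
  assumes "flat N l w" "flat N' l' w'" "dual_feasible \<eta> N l w" "gain \<eta> N l w \<le> gain \<eta> N' l' w'" "m < N'"
  shows "lag \<eta> N l w (w' m) = (cmod (cip (\<eta> (l' m)) (w' m)))\<^sup>2"
proof -
  let ?g = "\<lambda>m. lag \<eta> N l w (w' m) - (cmod (cip (\<eta> (l' m)) (w' m)))\<^sup>2"
  have g: "?g m \<ge> 0" if "m < N'" for m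
    using that assms by (simp add: dual_feasible_def flat_def)
  have "(\<Sum>m<N'. ?g m) = gain \<eta> N l w - gain \<eta> N' l' w'"
    by (simp add: sum_subtractf sum_lag[OF assms(1,2)] gain_def[of \<eta> N'])
  then have "(\<Sum>m<N'. ?g m) = 0" using assms(4) sum_nonneg[of "{..<N'}" ?g] g by auto
  then show ?thesis using sum_nonneg_eq_0_iff[of "{..<N'}" ?g] g assms(5) by auto
qed

text \<open>The combination v of x and y with \<open>cip (\<eta> i) v = 0\<close> is again a zero of
  the nonnegative form \<Gamma> - |\<eta> i><\<eta> i|, so \<open>lag\<close> vanishes at v. Dual
  feasibility makes v orthogonal to every state; it is also orthogonal to b, so independence gives v
  = 0.\<close>

lemma kernel_one_dim:
  assumes "indep3 \<eta>" "dual_feasible \<eta> N l w" "b \<noteq> 0" "\<And>i. i < 3 \<Longrightarrow> cip (\<eta> i) b = 0"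
    and i: "i < 3"
    and x: "cip b x = 0" "lag \<eta> N l w x = (cmod (cip (\<eta> i) x))\<^sup>2"
    and y: "cip b y = 0" "lag \<eta> N l w y = (cmod (cip (\<eta> i) y))\<^sup>2"
  shows "cip (\<eta> i) x *s y = cip (\<eta> i) y *s x"
proof -
  define v where "v = cip (\<eta> i) x *s y - cip (\<eta> i) y *s x"
  let ?g = "\<lambda>z. lag \<eta> N l w z - (cmod (cip (\<eta> i) z))\<^sup>2"
  have g: "?g z \<ge> 0" for z using assms(2) i by (simp add: dual_feasible_def)
  have sc: "?g (c *s z) = (cmod c)\<^sup>2 * ?g z" for c z
    by (simp add: lag_scale cip_simps norm_mult power_mult_distrib algebra_simps)
  have par: "?g (p + q) + ?g (p - q) = 2 * ?g p + 2 * ?g q" for p q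
    using lag_parallelogram[of \<eta> N l w p q] cip_parallelogram[of "\<eta> i" p q] by simp
  have "?g v = 0"
    using par[of "cip (\<eta> i) x *s y" "cip (\<eta> i) y *s x"] g[of v] g[of "cip (\<eta> i) x *s y + cip (\<eta> i) y *s x"]
      x y unfolding sc by (simp add: v_def)
  moreover have "cip (\<eta> i) v = 0" by (simp add: v_def cip_simps mult.commute)
  ultimately have "lag \<eta> N l w v = 0" by simp
  then have "cip (\<eta> j) v = 0" if "j < 3" for j
    using assms(2) that unfolding dual_feasible_def
    by (metis norm_eq_zero power2_less_eq_zero_iff)
  moreover have "cip b v = 0" using x y by (simp add: v_def cip_simps)
  ultimately have "b = 0 \<or> v = 0" using assms(1,4) unfolding indep3_def by blast
  then show ?thesis using assms(3) by (simp add: v_def)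
qed

text \<open>Supplies the nonzero coefficient when \<open>kernel_one_dim\<close> is solved for one of
  its vectors.\<close>

lemma kernel_nondegenerate:
  assumes "indep3 \<eta>" "dual_feasible \<eta> N l w" "b \<noteq> 0" "\<And>i. i < 3 \<Longrightarrow> cip (\<eta> i) b = 0"
    and "i < 3" "cip b x = 0" "lag \<eta> N l w x = (cmod (cip (\<eta> i) x))\<^sup>2" "x \<noteq> 0"
  shows "cip (\<eta> i) x \<noteq> 0"
proof
  assume "cip (\<eta> i) x = 0"
  then have "cip (\<eta> j) x = 0" if "j < 3" for j
    using assms(2,7) that unfolding dual_feasible_def
    by (metis norm_eq_zero power2_less_eq_zero_iff norm_zero zero_power2)
  then show False using assms(1,3,4,6,8) unfolding indep3_def by blast
qed

subsection \<open>Optimal frames\<close>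

definition orthonormal4 :: "(nat \<Rightarrow> bvec) \<Rightarrow> bool" where
  "orthonormal4 a \<longleftrightarrow> (\<forall>i<4. \<forall>j<4. cip (a i) (a j) = (if i = j then 1 else 0))"

text \<open>The vector \<open>a 3\<close> is orthogonal to all the states, so its outcome is immaterial; it
  announces outcome 2.\<close>

definition opt_frame :: "(nat \<Rightarrow> bvec) \<Rightarrow> (nat \<Rightarrow> bvec) \<Rightarrow> bool" where
  "opt_frame \<eta> a \<longleftrightarrow> orthonormal4 a \<and> (\<forall>i<3. cip (\<eta> i) (a 3) = 0) \<and>
     dual_feasible \<eta> 4 (\<lambda>k. min k 2) a"

lemma flat_frame: "orthonormal4 a \<Longrightarrow> flat 4 (\<lambda>k. min k 2) a"
  by (simp add: flat_def parseval orthonormal4_def min_def)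

lemma gain_le_dual:
  assumes "flat N l w" "flat N' l' w'" "dual_feasible \<eta> N l w"
  shows "gain \<eta> N' l' w' \<le> gain \<eta> N l w"
  unfolding sum_lag[OF assms(1,2), symmetric] gain_def[of \<eta> N']
  by (intro sum_mono) (use assms in \<open>auto simp: dual_feasible_def flat_def\<close>)

text \<open>By weak duality both ways the frames have equal gain, so slackness with the \<Gamma> of
  \<open>a\<close> applies to \<open>c\<close> as well and puts \<open>a 0\<close> and
  \<open>c 0\<close> in one kernel line. The vectors \<open>a 3\<close> and \<open>c 3\<close> both
  span the complement of the states.\<close>

lemma opt_frame_unique:
  assumes ind: "indep3 \<eta>" and a: "opt_frame \<eta> a" and c: "opt_frame \<eta> c"
  obtains \<alpha> \<beta> where "c 0 = \<alpha> *s a 0" "c 3 = \<beta> *s a 3"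
proof -
  let ?l = "\<lambda>k::nat. min k 2"
  have fa: "flat 4 ?l a" and fc: "flat 4 ?l c"
    using a c by (auto simp: opt_frame_def flat_frame)
  have da: "dual_feasible \<eta> 4 ?l a" and dc: "dual_feasible \<eta> 4 ?l c"
    using a c by (auto simp: opt_frame_def)
  have oa: "cip (a i) (a j) = (if i = j then 1 else 0)" if "i < 4" "j < 4" for i j
    using a that by (simp add: opt_frame_def orthonormal4_def)
  have oc: "cip (c i) (c j) = (if i = j then 1 else 0)" if "i < 4" "j < 4" for i j
    using c that by (simp add: opt_frame_def orthonormal4_def)
  have ha: "cip (\<eta> i) (a 3) = 0" and hc: "cip (\<eta> i) (c 3) = 0" if "i < 3" for i
    using a c that by (auto simp: opt_frame_def)
  have nz: "a 3 \<noteq> 0" "a 0 \<noteq> 0" "c 3 \<noteq> 0" using oa[of 3 3] oa[of 0 0] oc[of 3 3] by auto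
  define \<beta> where "\<beta> = cip (a 3) (c 3)"
  have b: "c 3 = \<beta> *s a 3"
  proof -
    have "cip (a 3) (c 3 - \<beta> *s a 3) = 0"
      using oa[of 3 3] by (simp add: cip_simps \<beta>_def)
    moreover have "cip (\<eta> i) (c 3 - \<beta> *s a 3) = 0" if "i < 3" for i
      using ha hc that by (simp add: cip_simps)
    ultimately show ?thesis using ind nz ha unfolding indep3_def
      by (metis eq_iff_diff_eq_0)
  qed
  have k: "lag \<eta> 4 ?l a (a 0) = (cmod (cip (\<eta> 0) (a 0)))\<^sup>2"
    "lag \<eta> 4 ?l a (c 0) = (cmod (cip (\<eta> 0) (c 0)))\<^sup>2"
    using slackness[OF fa fa da, of 0] slackness[OF fa fc da gain_le_dual[OF fc fa dc], of 0] by auto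
  have ort: "cip (a 3) (a 0) = 0" "cip (a 3) (c 0) = 0"
  proof -
    show "cip (a 3) (a 0) = 0" using oa[of 3 0] by simp
    have "\<beta> \<noteq> 0" using b nz by auto
    moreover have "cnj \<beta> * cip (a 3) (c 0) = 0"
      using oc[of 3 0] unfolding b by (simp add: cip_simps)
    ultimately show "cip (a 3) (c 0) = 0" by simp
  qed
  have "cip (\<eta> 0) (a 0) *s c 0 = cip (\<eta> 0) (c 0) *s a 0"
    by (rule kernel_one_dim[OF ind da nz(1) ha]) (use k ort in auto)
  moreover have "cip (\<eta> 0) (a 0) \<noteq> 0"
    by (rule kernel_nondegenerate[OF ind da nz(1) ha]) (use k ort nz in auto)
  ultimately have "c 0 = (cip (\<eta> 0) (c 0) / cip (\<eta> 0) (a 0)) *s a 0"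
    by (simp add: vec_eq_iff field_simps)
  then show ?thesis using b that by blast
qed

text \<open>The parts of the \<open>w k\<close> orthogonal to the complement b lie, outcome by
  outcome, on three lines; completeness forces these to be orthonormal. The two sums are the entries
  of \<Pi> 0 at (a 0, a 3) and (a 0, a 0), to which only outcome 0 contributes.\<close>

lemma frame_of_optimal:
  assumes ind: "indep3 \<eta>" and flat: "flat N l w" and dual: "dual_feasible \<eta> N l w"
  obtains a s t where "opt_frame \<eta> a"
    "\<And>k. k < N \<Longrightarrow> l k = 0 \<Longrightarrow> w k = s k *s a 0 + t k *s a 3"
    "(\<Sum>k | k < N \<and> l k = 0. s k * cnj (t k)) = 0"
    "(\<Sum>k | k < N \<and> l k = 0. s k * cnj (s k)) = 1"
proof -
  have l3: "l k < 3" if "k < N" for k using flat that by (simp add: flat_def)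
  have res: "(\<Sum>k<N. cip x (w k) * cip (w k) y) = cip x y" for x y
    using flat by (simp add: flat_def)
  obtain b where "norm b = 1" "cip (\<eta> 0) b = 0" "cip (\<eta> 1) b = 0" "cip (\<eta> 2) b = 0"
    by (rule ex_unit_orthogonal)
  then have b: "cip b b = 1" "b \<noteq> 0" "cip (\<eta> i) b = 0" "cip b (\<eta> i) = 0" if "i < 3" for i
    using that by (auto simp: cip_self less_3_cases cip_commute_eq_0[of b])
  define p where "p k = w k - cip b (w k) *s b" for k
  have pb: "cip b (p k) = 0" for k by (simp add: p_def cip_simps b(1)[of 0])
  have pk: "lag \<eta> N l w (p k) = (cmod (cip (\<eta> (l k)) (p k)))\<^sup>2" if k: "k < N" for k
  proof -
    let ?g = "\<lambda>z. lag \<eta> N l w z - (cmod (cip (\<eta> (l k)) z))\<^sup>2"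
    have g: "?g z \<ge> 0" for z using dual l3[OF k] by (simp add: dual_feasible_def)
    have "lag \<eta> N l w b = 0" unfolding lag_def by (simp add: b l3)
    then have gb: "?g (c *s b) = 0" for c
      using b(3) l3[OF k] by (simp add: lag_scale cip_simps)
    have gw: "?g (w k) = 0" using slackness[OF flat flat dual _ k] by simp
    have "?g (w k + cip b (w k) *s b) + ?g (p k) = 2 * ?g (w k) + 2 * ?g (cip b (w k) *s b)"
      using lag_parallelogram[of \<eta> N l w "w k" "cip b (w k) *s b"]
        cip_parallelogram[of "\<eta> (l k)" "w k" "cip b (w k) *s b"] unfolding p_def by argo
    then show ?thesis
      using g[of "w k + cip b (w k) *s b"] g[of "p k"] unfolding gb gw by argo
  qed
  have "\<exists>\<kappa>. cip b \<kappa> = 0 \<and> (\<forall>k<N. l k = i \<longrightarrow> (\<exists>s. p k = s *s \<kappa>))" if i: "i < 3" for i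
  proof (cases "\<exists>k<N. l k = i \<and> p k \<noteq> 0")
    case True
    then obtain k0 where k0: "k0 < N" "l k0 = i" "p k0 \<noteq> 0" by blast
    have nz: "cip (\<eta> i) (p k0) \<noteq> 0"
      by (rule kernel_nondegenerate[OF ind dual b(2)[OF i] b(3) i]) (use k0 pb pk in auto)
    have "\<exists>s. p k = s *s p k0" if k: "k < N" "l k = i" for k
    proof -
      have "cip (\<eta> i) (p k0) *s p k = cip (\<eta> i) (p k) *s p k0"
        by (rule kernel_one_dim[OF ind dual b(2)[OF i] b(3) i]) (use k0 k pb pk in auto)
      then have "p k = (cip (\<eta> i) (p k) / cip (\<eta> i) (p k0)) *s p k0"
        using nz by (simp add: vec_eq_iff field_simps)
      then show ?thesis by blast
    qed
    then show ?thesis using pb by blast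
  next
    case False
    \<comment> \<open>An outcome announced never, or only by multiples of b, provisionally gets the
      zero vector; completeness rules this out below.\<close>
    then show ?thesis by (intro exI[of _ 0]) auto
  qed
  then obtain \<kappa> where \<kappa>: "\<And>i. i < 3 \<Longrightarrow> cip b (\<kappa> i) = 0"
    "\<And>i k. i < 3 \<Longrightarrow> k < N \<Longrightarrow> l k = i \<Longrightarrow> \<exists>s. p k = s *s \<kappa> i" by metis
  then have "\<exists>s. k < N \<longrightarrow> p k = s *s \<kappa> (l k)" for k using l3[of k] by blast
  then obtain s0 where s0: "\<And>k. k < N \<Longrightarrow> p k = s0 k *s \<kappa> (l k)" by metis
  define t where "t k = cip b (w k)" for k
  have w0: "w k = s0 k *s \<kappa> (l k) + t k *s b" if "k < N" for k
    using s0[OF that] by (simp add: p_def t_def diff_eq_eq)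
  \<comment> \<open>A unit vector orthogonal to b and to the two other lines. Expanded in the
    resolution of the identity it receives contributions from outcome i alone, hence is a multiple
    of \<kappa> i. This gives \<kappa> i \<noteq> 0 and the orthogonality of the lines
    together.\<close>
  have "\<exists>x. norm x = 1 \<and> cip b x = 0 \<and> (\<forall>j<3. j \<noteq> i \<longrightarrow> cip (\<kappa> j) x = 0)" if i: "i < 3" for i
  proof -
    obtain x where x: "norm x = 1" "cip b x = 0" "cip (\<kappa> ((i+1) mod 3)) x = 0" "cip (\<kappa> ((i+2) mod 3)) x = 0"
      by (rule ex_unit_orthogonal)
    moreover have "j = (i+1) mod 3 \<or> j = (i+2) mod 3" if "j < 3" "j \<noteq> i" for j
      using i that unfolding less_3_cases by auto
    ultimately show ?thesis by metis
  qed
  then obtain x where x: "\<And>i. i < 3 \<Longrightarrow> norm (x i) = 1" "\<And>i. i < 3 \<Longrightarrow> cip b (x i) = 0"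
    "\<And>i j. i < 3 \<Longrightarrow> j < 3 \<Longrightarrow> j \<noteq> i \<Longrightarrow> cip (\<kappa> j) (x i) = 0" by metis
  have "\<exists>c. c \<noteq> 0 \<and> x i = c *s \<kappa> i" if i: "i < 3" for i
  proof -
    let ?K = "{k. k < N \<and> l k = i}"
    define C where "C = (\<Sum>k\<in>?K. s0 k * cnj (s0 k)) * cip (\<kappa> i) (x i)"
    define B where "B = (\<Sum>k\<in>?K. t k * cnj (s0 k)) * cip (\<kappa> i) (x i)"
    have xi: "cip y (x i) = C * cip y (\<kappa> i) + B * cip y b" for y
    proof -
      have wx: "cip (w k) (x i) = (if l k = i then cnj (s0 k) * cip (\<kappa> i) (x i) else 0)" if "k < N" for k
        using that i l3 x(2,3) by (auto simp: w0 cip_simps)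
      have "cip y (x i) = (\<Sum>k<N. if l k = i then cip y (w k) * (cnj (s0 k) * cip (\<kappa> i) (x i)) else 0)"
        unfolding res[of y "x i", symmetric] by (intro sum.cong) (auto simp: wx)
      also have "\<dots> = (\<Sum>k\<in>?K. cip y (w k) * (cnj (s0 k) * cip (\<kappa> i) (x i)))"
        by (simp add: sum.inter_filter[symmetric])
      also have "\<dots> = (\<Sum>k\<in>?K. s0 k * cnj (s0 k) * cip (\<kappa> i) (x i) * cip y (\<kappa> i)
          + t k * cnj (s0 k) * cip (\<kappa> i) (x i) * cip y b)"
        by (intro sum.cong) (auto simp: w0 cip_simps algebra_simps)
      also have "\<dots> = C * cip y (\<kappa> i) + B * cip y b"
        by (simp add: C_def B_def sum.distrib sum_distrib_right)
      finally show ?thesis .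
    qed
    have "B = 0" using xi[of b] x(2)[OF i] \<kappa>(1)[OF i] b(1)[OF i] by simp
    then have "x i = C *s \<kappa> i" by (intro cip_ext) (simp add: xi cip_simps)
    moreover have "C \<noteq> 0" using calculation x(1)[OF i] by auto
    ultimately show ?thesis by blast
  qed
  then obtain c where c: "\<And>i. i < 3 \<Longrightarrow> c i \<noteq> 0" "\<And>i. i < 3 \<Longrightarrow> x i = c i *s \<kappa> i" by metis
  define s where "s k = s0 k / c (l k)" for k
  define a where "a i = (if i < 3 then x i else b)" for i :: nat
  have w: "w k = s k *s a (l k) + t k *s b" if "k < N" for k
    using w0[OF that] c l3[OF that] by (simp add: s_def a_def)
  have xx: "cip (x i) (x j) = (if i = j then 1 else 0)" if "i < 3" "j < 3" for i j
  proof (cases "i = j")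
    case True then show ?thesis using x(1) that by (simp add: cip_self)
  next
    case False then show ?thesis using x(3)[of j i] that by (simp add: c(2)[of i] cip_simps)
  qed
  have o: "cip (a i) (a j) = (if i = j then 1 else 0)" if "i < 4" "j < 4" for i j
    using that xx x(2) b(1)[of 0] by (auto simp: a_def cip_commute_eq_0[of "x i" b])
  have sums: "(\<Sum>k | k < N \<and> l k = i. s k * cnj (t k)) = 0"
    "(\<Sum>k | k < N \<and> l k = i. s k * cnj (s k)) = 1" if i: "i < 3" for i
  proof -
    have aw: "cip (a i) (w k) = (if l k = i then s k else 0)" "cip (w k) (a i) = (if l k = i then cnj (s k) else 0)"
      "cip (w k) (a 3) = cnj (t k)" if "k < N" for k
      using that i l3[OF that] o[of i "l k"] o[of "l k" i] o[of i 3] o[of 3 i] o[of "l k" 3] o[of 3 3] w[OF that]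
      by (auto simp: cip_simps a_def)
    have "(\<Sum>k | k < N \<and> l k = i. s k * cnj (t k)) = (\<Sum>k<N. cip (a i) (w k) * cip (w k) (a 3))"
      by (subst sum.inter_filter[of "{..<N}", simplified]) (auto intro!: sum.cong simp: aw)
    then show "(\<Sum>k | k < N \<and> l k = i. s k * cnj (t k)) = 0" using i o[of i 3] by (simp add: res)
    have "(\<Sum>k | k < N \<and> l k = i. s k * cnj (s k)) = (\<Sum>k<N. cip (a i) (w k) * cip (w k) (a i))"
      by (subst sum.inter_filter[of "{..<N}", simplified]) (auto intro!: sum.cong simp: aw)
    then show "(\<Sum>k | k < N \<and> l k = i. s k * cnj (s k)) = 1" using i o[of i i] by (simp add: res)
  qed
  \<comment> \<open>The b parts drop out: the states are orthogonal to b, and the mixed terms carry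
    the vanishing sum of \<open>s k * cnj (t k)\<close>. So dual feasibility passes from w to the
    frame.\<close>
  have lag_eq: "lag \<eta> 4 (\<lambda>k. min k 2) a y = lag \<eta> N l w y" for y
  proof -
    have "(\<Sum>k<N. cip y (\<eta> (l k)) * cip (\<eta> (l k)) (w k) * cip (w k) y) =
      (\<Sum>i<3. \<Sum>k | k < N \<and> l k = i. cip y (\<eta> (l k)) * cip (\<eta> (l k)) (w k) * cip (w k) y)"
      by (rule sum.group[symmetric, of "{..<N}" "{..<3}" l, unfolded lessThan_iff]) (use l3 in auto)
    also have "\<dots> = (\<Sum>i<3. cip y (\<eta> i) * cip (\<eta> i) (a i) * cip (a i) y)"
    proof (intro sum.cong refl)
      fix i :: nat assume "i \<in> {..<3}"
      then have i: "i < 3" by simp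
      have "(\<Sum>k | k < N \<and> l k = i. cip y (\<eta> (l k)) * cip (\<eta> (l k)) (w k) * cip (w k) y) =
        (\<Sum>k | k < N \<and> l k = i. (cip y (\<eta> i) * cip (\<eta> i) (a i) * cip (a i) y) * (s k * cnj (s k)) +
          (cip y (\<eta> i) * cip (\<eta> i) (a i) * cip b y) * (s k * cnj (t k)))"
        using b(3)[OF i] by (intro sum.cong) (auto simp: w cip_simps algebra_simps)
      also have "\<dots> = cip y (\<eta> i) * cip (\<eta> i) (a i) * cip (a i) y"
        unfolding sum.distrib sum_distrib_left[symmetric] sums[OF i] by simp
      finally show "(\<Sum>k | k < N \<and> l k = i. cip y (\<eta> (l k)) * cip (\<eta> (l k)) (w k) * cip (w k) y) = \<dots>" .
    qed
    also have "\<dots> = (\<Sum>k<4. cip y (\<eta> (min k 2)) * cip (\<eta> (min k 2)) (a k) * cip (a k) y)"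
      using b(3)[of 2] by (simp add: sum_lessThan_3 sum_lessThan_4 a_def)
    finally show ?thesis by (simp add: lag_def)
  qed
  have "opt_frame \<eta> a"
    unfolding opt_frame_def orthonormal4_def using o b(3) dual lag_eq
    by (auto simp: dual_feasible_def a_def[of 3])
  moreover have "w k = s k *s a 0 + t k *s a 3" if "k < N" "l k = 0" for k
    using w[OF that(1)] that(2) by (simp add: a_def)
  ultimately show ?thesis using sums[of 0] by (intro that[of a s t]) simp_all
qed

subsection \<open>An obstruction to separability\<close>

text \<open>A vector is a product vector iff its \<open>2 \<times> 2\<close> coefficient matrix is singular.\<close>

definition det2 :: "bvec \<Rightarrow> complex" where
  "det2 v = v $ (0,0) * v $ (1,1) - v $ (0,1) * v $ (1,0)"

definition polar2 :: "bvec \<Rightarrow> bvec \<Rightarrow> complex" where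
  "polar2 u v = u $ (0,0) * v $ (1,1) + v $ (0,0) * u $ (1,1)
     - u $ (0,1) * v $ (1,0) - v $ (0,1) * u $ (1,0)"

text \<open>This is X - cnj X for X = det2 u det2 v (cnj (polar2 u v))^2, so it vanishes iff X is
  real. For nonzero \<open>polar2 u v\<close> that says that r1 r2 / (r1 + r2)^2 is real, where r1,
  r2 are the roots of r \<mapsto> det2 (u + r v), provided det2 v \<noteq> 0.\<close>

definition obstr :: "bvec \<Rightarrow> bvec \<Rightarrow> complex" where
  "obstr u v = det2 u * det2 v * (cnj (polar2 u v))\<^sup>2
     - cnj (det2 u * det2 v) * (polar2 u v)\<^sup>2"

lemma det2_comb: "det2 (s *s u + t *s v) = s\<^sup>2 * det2 u + s * t * polar2 u v + t\<^sup>2 * det2 v"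
  by (simp add: det2_def polar2_def power2_eq_square algebra_simps)

lemma obstr_scale: "obstr (\<alpha> *s u) (\<beta> *s v) = of_real ((cmod \<alpha>)^4 * (cmod \<beta>)^4) * obstr u v"
proof -
  have "of_real ((cmod \<alpha>)^4 * (cmod \<beta>)^4) = (\<alpha> * cnj \<alpha>)\<^sup>2 * (\<beta> * cnj \<beta>)\<^sup>2"
    unfolding complex_norm_square[symmetric] by (simp flip: power_mult)
  moreover have "det2 (\<alpha> *s u) = \<alpha>\<^sup>2 * det2 u" "det2 (\<beta> *s v) = \<beta>\<^sup>2 * det2 v"
    "polar2 (\<alpha> *s u) (\<beta> *s v) = \<alpha> * \<beta> * polar2 u v"
    by (simp_all add: det2_def polar2_def power2_eq_square algebra_simps)
  ultimately show ?thesis unfolding obstr_def by (simp add: power_mult_distrib algebra_simps)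
qed

text \<open>If product vectors \<open>s k u + t k v\<close> make up an operator that is diagonal in the basis
  \<open>u, v\<close>, then 0 is a convex combination of the at most two ratios \<open>t k / s k\<close>, the roots of
  a quadratic equation; hence these are real multiples of each other.\<close>

lemma obstr_separable:
  assumes fin: "finite K" and prod: "\<And>k. k \<in> K \<Longrightarrow> det2 (s k *s u + t k *s v) = 0"
    and "(\<Sum>k\<in>K. s k * cnj (t k)) = 0" "(\<Sum>k\<in>K. s k * cnj (s k)) = 1"
  shows "obstr u v = 0"
proof (cases "det2 u = 0 \<or> det2 v = 0")
  case True
  then show ?thesis by (auto simp: obstr_def)
next
  case False
  define d m e where "d = det2 v" and "m = polar2 u v" and "e = det2 u"
  have nz: "d \<noteq> 0" "e \<noteq> 0" using False by (auto simp: d_def e_def)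
  \<comment> \<open>By \<open>det2_comb\<close> a product vector with s k \<noteq> 0 has ratio r = t
    k / s k solving d r^2 + m r + e = 0.\<close>
  define r1 where "r1 = (- m + csqrt (m\<^sup>2 - 4 * d * e)) / (2 * d)"
  define r2 where "r2 = (- m - csqrt (m\<^sup>2 - 4 * d * e)) / (2 * d)"
  have m: "m = - d * (r1 + r2)" using nz by (simp add: r1_def r2_def field_simps)
  have e: "e = d * r1 * r2"
  proof -
    have "(- m + csqrt (m\<^sup>2 - 4 * d * e)) * (- m - csqrt (m\<^sup>2 - 4 * d * e)) = m\<^sup>2 - (csqrt (m\<^sup>2 - 4 * d * e))\<^sup>2"
      by (simp add: power2_eq_square algebra_simps)
    then have "(- m + csqrt (m\<^sup>2 - 4 * d * e)) * (- m - csqrt (m\<^sup>2 - 4 * d * e)) = 4 * d * e" by simp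
    then show ?thesis using nz by (simp add: r1_def r2_def field_simps)
  qed
  have root: "t k = r1 * s k \<or> t k = r2 * s k" if "k \<in> K" for k
  proof -
    have "d * ((t k - r1 * s k) * (t k - r2 * s k)) = 0"
      using prod[OF that] unfolding det2_comb d_def[symmetric] m_def[symmetric] e_def[symmetric] m e
      by (simp add: power2_eq_square algebra_simps)
    then show ?thesis using nz by simp
  qed
  \<comment> \<open>Indices with s k = 0 fall into the first class, and so do all indices if r1 =
    r2.\<close>
  define x where "x = (\<Sum>k\<in>{k\<in>K. t k = r1 * s k}. (cmod (s k))\<^sup>2)"
  define y where "y = (\<Sum>k\<in>{k\<in>K. t k \<noteq> r1 * s k}. (cmod (s k))\<^sup>2)"
  have split: "(\<Sum>k\<in>K. f k) = (\<Sum>k\<in>{k\<in>K. t k = r1 * s k}. f k) + (\<Sum>k\<in>{k\<in>K. t k \<noteq> r1 * s k}. f k)"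
    for f :: "_ \<Rightarrow> complex"
    using fin by (subst sum.union_disjoint[symmetric]) (auto intro!: sum.cong)
  have "(\<Sum>k\<in>K. s k * cnj (t k)) = cnj r1 * of_real x + cnj r2 * of_real y"
  proof -
    have "s k * cnj (t k) = cnj r1 * (s k * cnj (s k))" if "t k = r1 * s k" for k
      using that by simp
    moreover have "s k * cnj (t k) = cnj r2 * (s k * cnj (s k))" if "k \<in> K" "t k \<noteq> r1 * s k" for k
      using root[OF that(1)] that(2) by simp
    ultimately show ?thesis
      unfolding split x_def y_def of_real_sum complex_norm_square sum_distrib_left
      by (intro arg_cong2[where f = "(+)"] sum.cong) auto
  qed
  then have 0: "cnj r1 * of_real x + cnj r2 * of_real y = 0" using assms by simp
  have "(\<Sum>k\<in>K. s k * cnj (s k)) = of_real x + of_real y"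
    unfolding split x_def y_def of_real_sum complex_norm_square by simp
  then have xy: "x + y = 1" using assms by (metis of_real_add of_real_eq_1_iff)
  \<comment> \<open>If y were 0, then x = 1 and r1 = 0, whereas r1 r2 = e / d is nonzero.\<close>
  have "r1 \<noteq> 0" using e nz by auto
  then have "y \<noteq> 0" using 0 xy by auto
  define z where "z = - x / y"
  have "cnj r2 = of_real z * cnj r1"
    using 0 \<open>y \<noteq> 0\<close> by (simp add: z_def field_simps eq_neg_iff_add_eq_0)
  then have "r2 = of_real z * r1"
    by (metis complex_cnj_cancel_iff complex_cnj_complex_of_real complex_cnj_mult)
  \<comment> \<open>With r2 = z r1 the first term of \<open>obstr\<close> becomes |d|^4 |r1|^4 z (1
    + z)^2, which is real.\<close>
  then show ?thesis
    unfolding obstr_def d_def[symmetric] m_def[symmetric] e_def[symmetric] e unfolding m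
    by (simp add: power2_eq_square algebra_simps)
qed

subsection \<open>LOCC measurements are made of product vectors\<close>

definition outer :: "bvec \<Rightarrow> bop" where
  "outer v = (\<chi> i j. v $ i * cnj (v $ j))"

lemma outer_mult: "outer v *v x = cip v x *s v"
  by (simp add: outer_def matrix_vector_mult_def cip_def vec_eq_iff sum_distrib_left
      sum_distrib_right mult_ac)

lemma madj_outer: "madj (outer v) = outer v"
  by (simp add: madj_def outer_def vec_eq_iff mult.commute)

lemma madj_sum: "madj (\<Sum>k\<in>A. f k) = (\<Sum>k\<in>A. madj (f k))"
  by (simp add: madj_def vec_eq_iff)

lemma sum_matrix_vector_mult:
  fixes f :: "'a \<Rightarrow> complex^'n^'m" shows "(\<Sum>k\<in>A. f k) *v x = (\<Sum>k\<in>A. f k *v x)"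
  by (induction A rule: infinite_finite_induct) (simp_all add: matrix_vector_mult_add_rdistrib)

lemma matrix_add_rdistrib: "(A + B) ** C = A ** C + B ** (C :: complex^'p^'n)"
  by (simp add: matrix_matrix_mult_def vec_eq_iff sum.distrib algebra_simps)

lemma mult_sum_mult_matrix:
  fixes f :: "'a \<Rightarrow> complex^'n^'n" shows "L ** (\<Sum>k\<in>A. f k) ** R = (\<Sum>k\<in>A. L ** f k ** R)"
proof -
  have "L ** 0 ** R = 0" by (simp add: matrix_matrix_mult_def vec_eq_iff)
  then show ?thesis
    by (induction A rule: infinite_finite_induct) (simp_all add: matrix_add_ldistrib matrix_add_rdistrib)
qed

lemma qform_cip: "qform A v = cip v (A *v v)"
  by (simp add: qform_def cip_def)

lemma sum_UNIV_pair: "(\<Sum>p\<in>UNIV. f p) = (\<Sum>i\<in>UNIV. \<Sum>j\<in>UNIV. f (i, j))"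
  unfolding UNIV_Times_UNIV[symmetric] sum.cartesian_product by (simp add: case_prod_beta')

lemma tensor_mult: "tensor A B ** tensor C D = tensor (A ** C) (B ** D)"
  by (simp add: tensor_def matrix_matrix_mult_def vec_eq_iff sum_UNIV_pair sum_product mult_ac)

lemma madj_tensor: "madj (tensor A B) = tensor (madj A) (madj B)"
  by (simp add: tensor_def madj_def vec_eq_iff)

lemma tensor_one: "tensor (mat 1) (mat 1) = mat 1"
  by (auto simp: tensor_def mat_def vec_eq_iff prod_eq_iff)

lemma tensor_sum_left: "tensor (\<Sum>k\<in>A. f k) B = (\<Sum>k\<in>A. tensor (f k) B)"
  by (simp add: tensor_def vec_eq_iff sum_distrib_right)

lemma tensor_sum_right: "tensor B (\<Sum>k\<in>A. f k) = (\<Sum>k\<in>A. tensor B (f k))"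
  by (simp add: tensor_def vec_eq_iff sum_distrib_left)

text \<open>R carries the sum over all outcomes through the induction: below an accumulated Kraus
  operator K it is K^dag K, and at the root it becomes completeness.\<close>

definition realizes :: "nat \<Rightarrow> (nat \<times> bvec) list \<Rightarrow> (nat \<Rightarrow> bop) \<Rightarrow> bop \<Rightarrow> bool" where
  "realizes n ws E R \<longleftrightarrow> (\<forall>p\<in>set ws. fst p < n \<and> det2 (snd p) = 0) \<and>
     (\<forall>j. E j = (\<Sum>p\<leftarrow>ws. if fst p = j then outer (snd p) else 0)) \<and>
     R = (\<Sum>p\<leftarrow>ws. outer (snd p))"

lemma realizes_sum:
  assumes "\<And>k. k < (m::nat) \<Longrightarrow> \<exists>ws. realizes n ws (E k) (R k)"
  shows "\<exists>ws. realizes n ws (\<lambda>j. \<Sum>k<m. E k j) (\<Sum>k<m. R k)"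
  using assms
proof (induction m)
  case 0
  show ?case by (intro exI[of _ "[]"]) (simp add: realizes_def)
next
  case (Suc m)
  obtain ws where ws: "realizes n ws (\<lambda>j. \<Sum>k<m. E k j) (\<Sum>k<m. R k)"
    using Suc.IH Suc.prems by auto
  obtain ws' where ws': "realizes n ws' (E m) (R m)" using Suc.prems[of m] by auto
  have "realizes n (ws @ ws') (\<lambda>j. \<Sum>k<Suc m. E k j) (\<Sum>k<Suc m. R k)"
    using ws ws' unfolding realizes_def by auto
  then show ?case by blast
qed

text \<open>K^dag K is the sum of the projectors onto the conjugated rows of K, and each row of a
  tensor product is a product vector.\<close>

lemma realizes_tensor_stop:
  assumes "i < n"
  shows "\<exists>ws. realizes n ws (\<lambda>j. if j = i then madj (tensor A B) ** tensor A B else 0)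
    (madj (tensor A B) ** tensor A B)"
proof -
  define v where "v p = (\<chi> q. cnj (tensor A B $ p $ q))" for p
  have det: "det2 (v p) = 0" for p
    by (simp add: det2_def v_def tensor_def)
  have sum: "outer (v (0,0)) + outer (v (0,1)) + outer (v (1,0)) + outer (v (1,1))
    = madj (tensor A B) ** tensor A B"
    unfolding sum_pair2[of "\<lambda>p. outer (v p)", symmetric]
    by (simp add: vec_eq_iff outer_def v_def matrix_matrix_mult_def madj_def)
  show ?thesis
    by (rule exI[of _ "map (Pair i \<circ> v) [(0,0), (0,1), (1,0), (1,1)]"])
      (use assms in \<open>simp add: realizes_def det sum[symmetric] add.assoc\<close>)
qed

text \<open>Each local step multiplies one tensor factor, so K stays a product; local completeness
  collapses the sum over the branches back to K^dag K.\<close>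

lemma locc_realizes:
  "locc_from n K E \<Longrightarrow> K = tensor A B \<Longrightarrow> \<exists>ws. realizes n ws E (madj K ** K)"
proof (induction arbitrary: A B rule: locc_from.induct)
  case (stop i K)
  then show ?case using realizes_tensor_stop by auto
next
  case (alice C m K E)
  let ?K = "\<lambda>k. tensor (C k) (mat 1) ** K"
  have "\<exists>ws. realizes n ws (\<lambda>j. \<Sum>k<m. E k j) (\<Sum>k<m. madj (?K k) ** ?K k)"
  proof (rule realizes_sum)
    fix k assume "k < m"
    moreover have "?K k = tensor (C k ** A) B" by (simp add: alice.prems tensor_mult)
    ultimately show "\<exists>ws. realizes n ws (E k) (madj (?K k) ** ?K k)"
      using alice.IH by blast
  qed
  moreover have "(\<Sum>k<m. madj (?K k) ** ?K k) = madj K ** K"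
  proof -
    have "(\<Sum>k<m. madj (?K k) ** ?K k) = (\<Sum>k<m. madj K ** tensor (madj (C k) ** C k) (mat 1) ** K)"
      by (intro sum.cong refl)
        (simp add: madj_mult madj_tensor matrix_mul_assoc[symmetric], simp add: matrix_mul_assoc tensor_mult)
    also have "\<dots> = madj K ** K"
      by (simp add: mult_sum_mult_matrix[symmetric] tensor_sum_left[symmetric] alice.hyps tensor_one)
    finally show ?thesis .
  qed
  ultimately show ?case by simp
next
  case (bob C m K E)
  let ?K = "\<lambda>k. tensor (mat 1) (C k) ** K"
  have "\<exists>ws. realizes n ws (\<lambda>j. \<Sum>k<m. E k j) (\<Sum>k<m. madj (?K k) ** ?K k)"
  proof (rule realizes_sum)
    fix k assume "k < m"
    moreover have "?K k = tensor A (C k ** B)" by (simp add: bob.prems tensor_mult)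
    ultimately show "\<exists>ws. realizes n ws (E k) (madj (?K k) ** ?K k)"
      using bob.IH by blast
  qed
  moreover have "(\<Sum>k<m. madj (?K k) ** ?K k) = madj K ** K"
  proof -
    have "(\<Sum>k<m. madj (?K k) ** ?K k) = (\<Sum>k<m. madj K ** tensor (mat 1) (madj (C k) ** C k) ** K)"
      by (intro sum.cong refl)
        (simp add: madj_mult madj_tensor matrix_mul_assoc[symmetric], simp add: matrix_mul_assoc tensor_mult)
    also have "\<dots> = madj K ** K"
      by (simp add: mult_sum_mult_matrix[symmetric] tensor_sum_right[symmetric] bob.hyps tensor_one)
    finally show ?thesis .
  qed
  ultimately show ?case by simp
qed

section \<open>Rank-one measurements as POVMs, and their success probability\<close>

definition flat_op :: "nat \<Rightarrow> (nat \<Rightarrow> nat) \<Rightarrow> (nat \<Rightarrow> bvec) \<Rightarrow> nat \<Rightarrow> bop" where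
  "flat_op N l w j = (\<Sum>k<N. if l k = j then outer (w k) else 0)"

lemma locc_povm_flat:
  assumes "locc_povm 3 P"
  obtains N l w where "flat N l w" "P = flat_op N l w" "\<And>k. k < N \<Longrightarrow> det2 (w k) = 0"
proof -
  obtain ws where ws: "realizes 3 ws P (mat 1)"
    using locc_realizes[OF assms[unfolded locc_povm_def] tensor_one[symmetric]] by auto
  define l where "l k = fst (ws ! k)" for k
  define w where "w k = snd (ws ! k)" for k
  have lw: "l k < 3" "det2 (w k) = 0" if "k < length ws" for k
    using ws that nth_mem[OF that] unfolding realizes_def l_def w_def by blast+
  have one: "(\<Sum>k<length ws. outer (w k)) = mat 1"
    using ws by (simp add: realizes_def sum_list_sum_nth w_def atLeast0LessThan)
  have "(\<Sum>k<length ws. cip x (w k) * cip (w k) y) = cip x y" for x y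
  proof -
    have "cip x y = cip x ((\<Sum>k<length ws. outer (w k)) *v y)" by (simp add: one)
    then show ?thesis
      by (simp add: sum_matrix_vector_mult outer_mult cip_sum_right cip_simps mult.commute)
  qed
  then have "flat (length ws) l w" using lw by (simp add: flat_def)
  moreover have "P = flat_op (length ws) l w"
    using ws by (auto simp: fun_eq_iff realizes_def flat_op_def sum_list_sum_nth l_def w_def atLeast0LessThan
        intro!: sum.cong)
  ultimately show ?thesis using lw that by blast
qed

lemma qform_flat_op:
  "qform (flat_op N l w j) v = of_real (\<Sum>k<N. if l k = j then (cmod (cip v (w k)))\<^sup>2 else 0)"
proof -
  have "qform (if c then outer u else 0) v = of_real (if c then (cmod (cip v u))\<^sup>2 else 0)" for c u
    by (simp add: qform_cip outer_mult cip_simps cip_mult_swap cmod_cip_commute[of u])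
  then show ?thesis
    unfolding qform_cip flat_op_def sum_matrix_vector_mult cip_sum_right by (simp only: of_real_sum)
qed

lemma povm_flat_op:
  assumes "flat N l w" shows "povm 3 (flat_op N l w)"
proof -
  have "psd (flat_op N l w j)" for j
  proof -
    have "madj (if c then outer u else 0) = (if c then outer u else 0)" for c u
      by (simp add: madj_outer) (simp add: madj_def vec_eq_iff)
    then have "madj (flat_op N l w j) = flat_op N l w j"
      unfolding flat_op_def madj_sum by simp
    then show ?thesis by (simp add: psd_def qform_flat_op sum_nonneg)
  qed
  moreover have "(\<Sum>j<3. flat_op N l w j) = mat 1"
  proof -
    have "(\<Sum>j<3. flat_op N l w j) = (\<Sum>k<N. outer (w k))"
      unfolding flat_op_def using assms
      by (subst sum.swap) (intro sum.cong, auto simp: flat_def sum.delta')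
    moreover have "(\<Sum>k<N. outer (w k)) *v y = mat 1 *v y" for y
      using assms
      by (intro cip_ext) (simp add: sum_matrix_vector_mult outer_mult cip_sum_right cip_simps
          mult.commute flat_def)
    ultimately show ?thesis by (metis matrix_eq)
  qed
  ultimately show ?thesis by (simp add: povm_def)
qed

definition weighted :: "(nat \<Rightarrow> real) \<Rightarrow> (nat \<Rightarrow> bvec) \<Rightarrow> nat \<Rightarrow> bvec" where
  "weighted p \<psi> i = of_real (sqrt (p i)) *s \<psi> i"

lemma succ_prob_flat_op:
  assumes "flat N l w" "\<forall>i<3. 0 < p i"
  shows "succ_prob 3 p \<psi> (flat_op N l w) = gain (weighted p \<psi>) N l w"
proof -
  have "succ_prob 3 p \<psi> (flat_op N l w) =
    (\<Sum>k<N. \<Sum>i<3. if l k = i then p i * (cmod (cip (\<psi> i) (w k)))\<^sup>2 else 0)"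
    unfolding succ_prob_def qform_flat_op Re_complex_of_real sum_distrib_left
    by (subst sum.swap) (intro sum.cong, auto)
  also have "\<dots> = (\<Sum>k<N. p (l k) * (cmod (cip (\<psi> (l k)) (w k)))\<^sup>2)"
    using assms(1) by (intro sum.cong) (auto simp: flat_def sum.delta')
  also have "\<dots> = gain (weighted p \<psi>) N l w"
    unfolding gain_def using assms
    by (intro sum.cong) (auto simp: weighted_def cip_simps norm_mult power_mult_distrib flat_def
        less_imp_le)
  finally show ?thesis .
qed

text \<open>\<open>opt_succ\<close> is a supremum of reals, so it dominates its members only once
  boundedness is known. Each POVM element is at most the identity.\<close>

lemma bdd_above_succ_prob:
  assumes "\<forall>i<n. 0 \<le> p i" shows "bdd_above (succ_prob n p \<psi> ` {P. povm n P})"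
proof (rule bdd_aboveI2)
  fix P assume "P \<in> {P. povm n P}"
  then have P: "povm n P" by simp
  show "succ_prob n p \<psi> P \<le> (\<Sum>i<n. p i * (norm (\<psi> i))\<^sup>2)"
    unfolding succ_prob_def
  proof (intro sum_mono mult_left_mono)
    fix i assume i: "i \<in> {..<n}"
    let ?v = "\<psi> i"
    have "Re (qform (P i) ?v) \<le> (\<Sum>j<n. Re (qform (P j) ?v))"
      using P i member_le_sum[of i "{..<n}" "\<lambda>j. Re (qform (P j) ?v)"] by (simp add: povm_def psd_def)
    also have "\<dots> = Re (qform (\<Sum>j<n. P j) ?v)"
      by (simp add: qform_cip sum_matrix_vector_mult cip_sum_right)
    also have "\<dots> = (norm ?v)\<^sup>2"
      using P by (simp add: povm_def qform_cip cip_self del: of_real_power)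
    finally show "Re (qform (P i) ?v) \<le> (norm ?v)\<^sup>2" .
  qed (use assms in auto)
qed

text \<open>Every flat family is a POVM, hence a competitor in the supremum. An LOCC measurement
  attaining it therefore maximises the gain, which starts the variational argument.\<close>

lemma locc_optimal_flat:
  assumes p: "\<forall>i<3. 0 < p i" and P: "locc_povm 3 P" "succ_prob 3 p \<psi> P = opt_succ 3 p \<psi>"
  obtains N l w where "flat N l w" "\<And>k. k < N \<Longrightarrow> det2 (w k) = 0"
    "dual_feasible (weighted p \<psi>) N l w"
proof -
  obtain N l w where w: "flat N l w" "P = flat_op N l w" "\<And>k. k < N \<Longrightarrow> det2 (w k) = 0"
    by (rule locc_povm_flat[OF P(1)]) (rule that)
  have "gain (weighted p \<psi>) N' l' w' \<le> gain (weighted p \<psi>) N l w" if f: "flat N' l' w'" for N' l' w'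
  proof -
    have "succ_prob 3 p \<psi> (flat_op N' l' w') \<le> opt_succ 3 p \<psi>"
      unfolding opt_succ_def using p
      by (intro cSUP_upper bdd_above_succ_prob) (auto simp: povm_flat_op f less_imp_le)
    then show ?thesis
      using P(2) p by (simp add: w(1,2) f succ_prob_flat_op)
  qed
  then have "dual_feasible (weighted p \<psi>) N l w" by (intro dual_feasible_optimal w(1))
  then show ?thesis using w that[of N l w] by simp
qed

lemma locc_optimal_frame:
  assumes "\<forall>i<3. 0 < p i" "indep3 (weighted p \<psi>)"
    and "locc_povm 3 P" "succ_prob 3 p \<psi> P = opt_succ 3 p \<psi>"
  obtains a where "opt_frame (weighted p \<psi>) a" "obstr (a 0) (a 3) = 0"
proof -
  obtain N l w where w: "flat N l w" "\<And>k. k < N \<Longrightarrow> det2 (w k) = 0"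
    "dual_feasible (weighted p \<psi>) N l w"
    by (rule locc_optimal_flat[OF assms(1,3,4)]) (rule that)
  obtain a s t where a: "opt_frame (weighted p \<psi>) a"
    "\<And>k. k < N \<Longrightarrow> l k = 0 \<Longrightarrow> w k = s k *s a 0 + t k *s a 3"
    "(\<Sum>k | k < N \<and> l k = 0. s k * cnj (t k)) = 0"
    "(\<Sum>k | k < N \<and> l k = 0. s k * cnj (s k)) = 1"
    by (rule frame_of_optimal[OF assms(2) w(1,3)]) (rule that)
  have "obstr (a 0) (a 3) = 0"
  proof (rule obstr_separable[OF _ _ a(3,4)])
    fix k assume "k \<in> {k. k < N \<and> l k = 0}"
    then show "det2 (s k *s a 0 + t k *s a 3) = 0" using a(2)[of k] w(2)[of k] by simp
  qed simp
  then show ?thesis using a(1) that[of a] by simp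
qed

subsection \<open>Null sets of the Haar measure\<close>

definition mscale :: "complex \<Rightarrow> bop \<Rightarrow> bop" where
  "mscale c A = (\<chi> i j. c * A $ i $ j)"

lemma mscale_mult: "mscale c A ** B = mscale c (A ** B)" "A ** mscale c B = mscale c (A ** B)"
  by (simp_all add: mscale_def matrix_matrix_mult_def vec_eq_iff sum_distrib_left mult_ac)

lemma mscale_vector: "mscale c A *v x = c *s (A *v x)"
  by (simp add: mscale_def matrix_vector_mult_def vec_eq_iff sum_distrib_left mult_ac)

lemma mscale_mscale: "mscale c (mscale d A) = mscale (c * d) A"
  by (simp add: mscale_def vec_eq_iff mult_ac)

lemma mscale_add: "mscale c (A + B) = mscale c A + mscale c B"
  "mscale (c + d) A = mscale c A + mscale d A"
  by (simp_all add: mscale_def vec_eq_iff algebra_simps)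

lemma mscale_one [simp]: "mscale 1 A = A"
  by (simp add: mscale_def)

lemma mscale_zero [simp]: "mscale 0 A = 0"
  by (simp add: mscale_def vec_eq_iff)

lemma madj_mscale: "madj (mscale c A) = mscale (cnj c) (madj A)"
  by (simp add: madj_def mscale_def vec_eq_iff)

lemma madj_add: "madj (A + B) = madj A + madj B"
  by (simp add: madj_def vec_eq_iff)

lemma continuous_on_matrix_mult [continuous_intros]:
  fixes f :: "'a::topological_space \<Rightarrow> complex^'n^'m" and g :: "'a \<Rightarrow> complex^'p^'n"
  assumes "continuous_on S f" "continuous_on S g" shows "continuous_on S (\<lambda>x. f x ** g x)"
  unfolding matrix_matrix_mult_def by (intro continuous_intros assms)

lemma continuous_on_matrix_vector_mult [continuous_intros]:
  fixes f :: "'a::topological_space \<Rightarrow> complex^'n^'m" and g :: "'a \<Rightarrow> complex^'n"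
  assumes "continuous_on S f" "continuous_on S g" shows "continuous_on S (\<lambda>x. f x *v g x)"
  unfolding matrix_vector_mult_def by (intro continuous_intros assms)

lemma continuous_on_cip [continuous_intros]:
  assumes "continuous_on S f" "continuous_on S g" shows "continuous_on S (\<lambda>x. cip (f x) (g x))"
  unfolding cip_def by (intro continuous_intros assms)

lemma continuous_on_mscale [continuous_intros]:
  assumes "continuous_on S c" "continuous_on S f" shows "continuous_on S (\<lambda>x. mscale (c x) (f x))"
  unfolding mscale_def by (intro continuous_intros assms)

lemma continuous_on_obstr [continuous_intros]:
  assumes "continuous_on S f" "continuous_on S g" shows "continuous_on S (\<lambda>x. obstr (f x) (g x))"
  unfolding obstr_def det2_def polar2_def by (intro continuous_intros assms)

section \<open>Functions that are polynomial along real lines\<close>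

definition real_poly :: "(real \<Rightarrow> complex) \<Rightarrow> bool" where
  "real_poly h \<longleftrightarrow> (\<exists>q. \<forall>u. h u = poly q (of_real u))"

lemma real_polyI: "(\<And>u. h u = poly q (of_real u)) \<Longrightarrow> real_poly h"
  unfolding real_poly_def by (rule exI[of _ q]) simp

lemma real_poly_affine: "real_poly (\<lambda>u. a + of_real u * b)"
  by (rule real_polyI[of _ "[:a, b:]"]) simp

lemma real_poly_const: "real_poly (\<lambda>u. a)"
  by (rule real_polyI[of _ "[:a:]"]) simp

lemma
  assumes "real_poly f" "real_poly g"
  shows real_poly_add: "real_poly (\<lambda>u. f u + g u)"
    and real_poly_diff: "real_poly (\<lambda>u. f u - g u)"
    and real_poly_mult: "real_poly (\<lambda>u. f u * g u)"
proof -
  from assms(1) obtain p where p: "\<forall>u. f u = poly p (of_real u)" unfolding real_poly_def ..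
  from assms(2) obtain q where q: "\<forall>u. g u = poly q (of_real u)" unfolding real_poly_def ..
  show "real_poly (\<lambda>u. f u + g u)" by (rule real_polyI[of _ "p + q"]) (simp add: p q)
  show "real_poly (\<lambda>u. f u - g u)" by (rule real_polyI[of _ "p - q"]) (simp add: p q)
  show "real_poly (\<lambda>u. f u * g u)" by (rule real_polyI[of _ "p * q"]) (simp add: p q)
qed

lemma real_poly_power: "real_poly f \<Longrightarrow> real_poly (\<lambda>u. f u ^ n)"
  by (induction n) (simp_all add: real_poly_const real_poly_mult)

text \<open>Here it matters that the variable is real: conjugation acts on the coefficients
  only.\<close>

lemma real_poly_cnj: assumes "real_poly f" shows "real_poly (\<lambda>u. cnj (f u))"
proof -
  from assms obtain q where q: "\<forall>u. f u = poly q (of_real u)" unfolding real_poly_def ..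
  have "cnj (f u) = poly (map_poly cnj q) (of_real u)" for u
    unfolding q[rule_format] poly_cnj complex_cnj_complex_of_real ..
  then show ?thesis by (rule real_polyI)
qed

lemma real_poly_sum: "(\<And>i. i \<in> A \<Longrightarrow> real_poly (f i)) \<Longrightarrow> real_poly (\<lambda>u. \<Sum>i\<in>A. f i u)"
  by (induction A rule: infinite_finite_induct) (simp_all add: real_poly_const real_poly_add)

lemmas real_poly_intros = real_poly_const real_poly_add real_poly_diff real_poly_mult
  real_poly_power real_poly_cnj real_poly_sum

lemma real_poly_matrix:
  "real_poly (\<lambda>u. ((X + mscale (of_real u) Y) *v a) $ i)"
proof -
  have "((X + mscale (of_real u) Y) *v a) $ i = (X *v a) $ i + of_real u * (Y *v a) $ i" for u
    by (simp add: matrix_vector_mult_add_rdistrib mscale_vector)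
  then show ?thesis by (simp add: real_poly_affine)
qed

text \<open>What the curves 1 + i t S demand of f: a closed, hence measurable zero set, indifference
  to the normalising factor, and finitely many zeros in t unless f vanishes identically
  there.\<close>

definition admissible :: "(bop \<Rightarrow> complex) \<Rightarrow> bool" where
  "admissible f \<longleftrightarrow> continuous_on UNIV f \<and>
     (\<forall>c A. c \<noteq> 0 \<longrightarrow> (f (mscale c A) = 0 \<longleftrightarrow> f A = 0)) \<and>
     (\<forall>X Y. real_poly (\<lambda>u. f (X + mscale (of_real u) Y)))"

lemma admissible_translate:
  assumes "admissible f" shows "admissible (\<lambda>V. f (A ** V))"
  unfolding admissible_def
proof (intro conjI allI impI)
  have f: "continuous_on UNIV f" using assms by (simp add: admissible_def)
  show "continuous_on UNIV (\<lambda>V. f (A ** V))"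
    by (rule continuous_on_compose2[OF f]) (auto intro!: continuous_intros)
  show "f (A ** mscale c V) = 0 \<longleftrightarrow> f (A ** V) = 0" if "c \<noteq> 0" for c V
    using assms that by (simp add: admissible_def mscale_mult)
  show "real_poly (\<lambda>u. f (A ** (X + mscale (of_real u) Y)))" for X Y
    using assms by (simp add: admissible_def mscale_mult matrix_add_ldistrib)
qed

lemma finite_zeros_real_poly:
  assumes "real_poly h" "h 0 \<noteq> 0" shows "finite {u. h u = 0}"
proof -
  obtain q where q: "\<And>u. h u = poly q (of_real u)" using assms by (auto simp: real_poly_def)
  have "q \<noteq> 0" using q[of 0] assms(2) by auto
  then have "finite {z. poly q z = 0}" by (rule poly_roots_finite)
  then have "finite (complex_of_real -` {z. poly q z = 0})"
    by (rule finite_vimageI) (simp add: inj_on_def)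
  then show ?thesis by (simp add: q vimage_def)
qed

text \<open>Y is the point at infinity of the line. Homogeneity and the substitution of 1/t for t
  exchange it with t = 0.\<close>

lemma finite_zeros_line:
  assumes f: "admissible f" and "f X \<noteq> 0 \<or> f Y \<noteq> 0"
  shows "finite {t::real. f (X + mscale (\<i> * of_real t) Y) = 0}"
  using assms(2)
proof
  assume "f X \<noteq> 0"
  moreover have "real_poly (\<lambda>t. f (X + mscale (of_real t) (mscale \<i> Y)))"
    using f by (simp add: admissible_def)
  ultimately show ?thesis
    using finite_zeros_real_poly[of "\<lambda>t. f (X + mscale (of_real t) (mscale \<i> Y))"]
    by (simp add: mscale_mscale mult.commute)
next
  assume "f Y \<noteq> 0"
  moreover have "real_poly (\<lambda>t. f (Y + mscale (of_real t) (mscale (- \<i>) X)))"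
    using f by (simp add: admissible_def)
  ultimately have fin: "finite {u::real. f (Y + mscale (of_real u) (mscale (- \<i>) X)) = 0}" (is "finite ?Z")
    using finite_zeros_real_poly[of "\<lambda>t. f (Y + mscale (of_real t) (mscale (- \<i>) X))"] by simp
  have "{t::real. f (X + mscale (\<i> * of_real t) Y) = 0} \<subseteq> insert 0 (inverse ` ?Z)"
  proof
    fix t :: real assume t: "t \<in> {t. f (X + mscale (\<i> * of_real t) Y) = 0}"
    show "t \<in> insert 0 (inverse ` ?Z)"
    proof (cases "t = 0")
      case False
      have "X + mscale (\<i> * of_real t) Y =
        mscale (\<i> * of_real t) (Y + mscale (of_real (inverse t)) (mscale (- \<i>) X))"
        using False by (simp add: mscale_add mscale_mscale field_simps)
      then have "f (Y + mscale (of_real (inverse t)) (mscale (- \<i>) X)) = 0"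
        using f t False by (simp add: admissible_def)
      then have "inverse t \<in> ?Z" by simp
      then have "inverse (inverse t) \<in> inverse ` ?Z" by (rule imageI)
      then show ?thesis by simp
    qed simp
  qed
  then show ?thesis using fin by (meson finite_imageI finite_insert finite_subset)
qed

lemma haar_prob: assumes "haar M" shows "finite_measure M" "sigma_finite_measure M" "emeasure M UNIV = 1"
  and "space M = UNIV" "sets M = sets borel"
proof -
  show s: "sets M = sets borel" using assms by (simp add: haar_def)
  then show sp: "space M = UNIV" using sets_eq_imp_space_eq by fastforce
  then show "emeasure M UNIV = 1" using assms by (simp add: haar_def)
  then show f: "finite_measure M" by (intro finite_measureI) (simp add: sp)
  then show "sigma_finite_measure M" by (simp add: finite_measure_def)
qed

lemma haar_AE_unitary: assumes "haar M" shows "AE V in M. unitary_op V"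
proof -
  interpret finite_measure M using haar_prob[OF assms] by blast
  have "closed {U :: bop. madj U ** U = mat 1}"
    unfolding madj_def by (intro closed_Collect_eq continuous_intros)
  then have m: "{U. unitary_op U} \<in> sets M"
    using haar_prob(5)[OF assms] by (simp add: unitary_op_def)
  have "emeasure M (space M - {U. unitary_op U}) = 0"
    using assms m by (subst emeasure_compl) (auto simp: haar_def)
  then show ?thesis
    using m by (intro AE_I[of _ _ "space M - {U. unitary_op U}"]) auto
qed

text \<open>For a Hermitian involution \<open>S\<close> the matrices \<open>(1 + i t S) / sqrt (1 + t\<^sup>2)\<close> are unitary. By
  invariance and Fubini, the measure of the zero set of \<open>f\<close> is the average over \<open>t \<in> [0,1]\<close> and
  \<open>V\<close> of the indicator of \<open>f ((1 + i t S) V) = 0\<close>; the polynomial in \<open>t\<close> has constant term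
  \<open>f V\<close> and leading term \<open>f (S V)\<close>.\<close>

lemma haar_zero_involution:
  assumes M: "haar M" and f: "admissible f" and S: "madj S = S" "S ** S = mat 1"
  shows "AE V in M. f V = 0 \<longrightarrow> f (S ** V) = 0"
proof -
  note hp = haar_prob[OF M]
  interpret M: finite_measure M by (rule hp)
  interpret P: pair_sigma_finite lborel M by unfold_locales
  have cont: "continuous_on UNIV f" and hom: "\<And>c A. c \<noteq> 0 \<Longrightarrow> f (mscale c A) = 0 \<longleftrightarrow> f A = 0"
    using f by (auto simp: admissible_def)
  define Z where "Z = {V. f V = 0}"
  define Z' where "Z' = {V. f V = 0 \<and> f (S ** V) = 0}"
  have cZ: "closed Z" unfolding Z_def by (intro closed_Collect_eq cont continuous_intros)
  have "continuous_on UNIV (\<lambda>V. f (S ** V))"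
    by (rule continuous_on_compose2[OF cont]) (auto intro!: continuous_intros)
  then have cZ': "closed Z'" unfolding Z'_def
    by (intro closed_Collect_conj closed_Collect_eq cont continuous_intros)
  have Z: "Z \<in> sets M" "Z' \<in> sets M" using cZ cZ' hp(5) by auto
  define E :: "(real \<times> bop) set" where
    "E = {x. 0 \<le> fst x \<and> fst x \<le> 1 \<and> f (snd x + mscale (\<i> * of_real (fst x)) (S ** snd x)) = 0}"
  have "continuous_on UNIV (\<lambda>x::real \<times> bop. f (snd x + mscale (\<i> * of_real (fst x)) (S ** snd x)))"
    by (rule continuous_on_compose2[OF cont]) (auto intro!: continuous_intros)
  then have "closed E" unfolding E_def
    by (intro closed_Collect_conj closed_Collect_eq closed_Collect_le continuous_intros)
  moreover have "sets (lborel \<Otimes>\<^sub>M M) = sets (borel :: (real \<times> bop) measure)"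
    unfolding borel_prod[symmetric] by (rule sets_pair_measure_cong) (simp_all add: hp)
  ultimately have E: "E \<in> sets (lborel \<Otimes>\<^sub>M M)" by simp
  have slice: "emeasure M (Pair t -` E) = indicator {0..1} t * emeasure M Z" for t
  proof (cases "t \<in> {0..1}")
    case True
    define r where "r = complex_of_real (1 / sqrt (1 + t\<^sup>2))"
    define G where "G = mscale r (mat 1 + mscale (\<i> * of_real t) S)"
    define s where "s = sqrt (1 + t\<^sup>2)"
    have "1 + t\<^sup>2 > 0" by (simp add: add_pos_nonneg)
    then have s: "s > 0" "1 + t\<^sup>2 = s * s" by (auto simp: s_def)
    have rs: "r = of_real (1 / s)" by (simp add: r_def s_def)
    have r: "r \<noteq> 0" "cnj r * r * of_real (1 + t\<^sup>2) = 1"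
      unfolding rs s(2) using s(1) by simp_all
    \<comment> \<open>The terms linear in t cancel because S is Hermitian, and S ** S = 1 leaves the
      scalar 1 + t^2.\<close>
    have "madj G ** G = mscale (cnj r * r) (mscale (of_real (1 + t\<^sup>2)) (mat 1))"
      by (simp add: G_def madj_mscale madj_add S mscale_mult mscale_mscale matrix_add_ldistrib
          matrix_add_rdistrib mscale_add power2_eq_square)
        (simp add: mscale_def vec_eq_iff algebra_simps)
    then have "unitary_op G" using r by (simp add: unitary_op_def mscale_mscale)
    then have "emeasure M ((\<lambda>U. G ** U) -` Z) = emeasure M Z"
      using M Z hp(5) by (simp add: haar_def)
    moreover have "(\<lambda>U. G ** U) -` Z = Pair t -` E"
      using True r by (auto simp: Z_def E_def G_def mscale_mult matrix_add_rdistrib hom)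
    ultimately show ?thesis using True by simp
  qed (auto simp: E_def)
  \<comment> \<open>The interval of t has length 1, which bounds the slice for V in Z'; for every
    other V the slice is finite. Integrated over V, this shows that Z' is as large as Z.\<close>
  have null: "emeasure lborel ((\<lambda>t. (t, V)) -` E) \<le> indicator Z' V" for V
  proof (cases "V \<in> Z'")
    case True
    have "emeasure lborel ((\<lambda>t. (t, V)) -` E) \<le> emeasure lborel {0..1::real}"
      by (rule emeasure_mono) (auto simp: E_def)
    then show ?thesis using True by simp
  next
    case False
    have "finite {t::real. f (V + mscale (\<i> * of_real t) (S ** V)) = 0}"
      using False by (intro finite_zeros_line f) (auto simp: Z'_def)
    then have "finite ((\<lambda>t. (t, V)) -` E)" by (rule rev_finite_subset) (auto simp: E_def)
    then show ?thesis using emeasure_lborel_countable uncountable_infinite by (metis countable_finite zero_le)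
  qed
  have "emeasure M Z = (\<integral>\<^sup>+t. emeasure M (Pair t -` E) \<partial>lborel)"
    unfolding slice by (subst nn_integral_multc) auto
  also have "\<dots> = emeasure (lborel \<Otimes>\<^sub>M M) E" by (rule M.emeasure_pair_measure_alt[symmetric, OF E])
  also have "\<dots> = (\<integral>\<^sup>+V. emeasure lborel ((\<lambda>t. (t, V)) -` E) \<partial>M)"
    by (rule P.emeasure_pair_measure_alt2[OF E])
  also have "\<dots> \<le> (\<integral>\<^sup>+V. indicator Z' V \<partial>M)" by (intro nn_integral_mono null)
  also have "\<dots> = emeasure M Z'" using Z by simp
  finally have "emeasure M Z \<le> emeasure M Z'" .
  moreover have "Z' \<subseteq> Z" by (auto simp: Z_def Z'_def)
  ultimately have "emeasure M (Z - Z') = 0"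
    using Z by (subst emeasure_Diff)
      (auto intro: antisym emeasure_mono simp: diff_eq_0_iff_ennreal M.emeasure_finite less_top[symmetric])
  then show ?thesis
    using Z by (intro AE_I[of _ _ "Z - Z'"]) (auto simp: Z_def Z'_def)
qed

section \<open>Transport of zero sets by reflections\<close>

text \<open>The reflection in the hyperplane orthogonal to \<open>v\<close>, multiplied by \<open>|v|\<^sup>2\<close> to make it
  continuous in \<open>v\<close>, also at 0.\<close>

definition hrefl :: "bvec \<Rightarrow> bop" where
  "hrefl v = mscale (cip v v) (mat 1) + mscale (- 2) (outer v)"

lemma hrefl_vector: "hrefl v *v x = cip v v *s x - (2 * cip v x) *s v"
  by (simp add: hrefl_def matrix_vector_mult_add_rdistrib mscale_vector outer_mult vec_eq_iff)

lemma madj_hrefl: "madj (hrefl v) = hrefl v"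
  by (simp add: hrefl_def madj_add madj_mscale madj_outer)

lemma hrefl_hrefl_vector: "hrefl v *v (hrefl v *v x) = (cip v v)\<^sup>2 *s x"
  by (simp add: hrefl_vector cip_simps vec_eq_iff power2_eq_square algebra_simps)

lemma hrefl_square: "hrefl v ** hrefl v = mscale ((cip v v)\<^sup>2) (mat 1)"
  unfolding matrix_eq by (simp add: matrix_vector_mul_assoc[symmetric] hrefl_hrefl_vector mscale_vector)

lemma cip_hrefl: "cip (hrefl v *v x) (hrefl v *v y) = (cip v v)\<^sup>2 * cip x y"
  by (simp add: cip_adj madj_hrefl hrefl_hrefl_vector cip_simps mult.commute flip: power_mult)

lemma haar_zero_hrefl:
  assumes M: "haar M" and f: "admissible f" and v: "v \<noteq> 0"
  shows "AE V in M. f V = 0 \<longrightarrow> f (hrefl v ** V) = 0"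
proof -
  define S where "S = mscale (1 / cip v v) (hrefl v)"
  have "AE V in M. f V = 0 \<longrightarrow> f (S ** V) = 0"
  proof (rule haar_zero_involution[OF M f])
    show "madj S = S" by (simp add: S_def madj_mscale madj_hrefl)
    show "S ** S = mat 1"
      using v by (simp add: S_def mscale_mult mscale_mscale hrefl_square power2_eq_square)
  qed
  moreover have "f (S ** V) = 0 \<longleftrightarrow> f (hrefl v ** V) = 0" for V
    using f v by (simp add: S_def mscale_mult admissible_def)
  ultimately show ?thesis by simp
qed

text \<open>Exceptional null sets can be united over countably many pairs (v, w) only, hence a dense
  set D. For V outside them with f V = 0, the pairs with nonzero value would form a nonempty open
  set that misses D.\<close>

lemma haar_AE_nonzero:
  assumes M: "haar M" and f: "admissible f"
    and ex: "\<And>X. unitary_op X \<Longrightarrow> \<exists>v w. v \<noteq> 0 \<and> w \<noteq> 0 \<and> f (hrefl w ** (hrefl v ** X)) \<noteq> 0"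
  shows "AE V in M. f V \<noteq> 0"
proof -
  obtain D :: "(bvec \<times> bvec) set" where D: "countable D"
    "\<And>X. open X \<Longrightarrow> X \<noteq> {} \<Longrightarrow> \<exists>d\<in>D. d \<in> X" using countable_dense_setE by blast
  have step: "AE V in M. f V = 0 \<longrightarrow> f (hrefl w ** (hrefl v ** V)) = 0" if "v \<noteq> 0" "w \<noteq> 0" for v w
    using haar_zero_hrefl[OF M f that(2)] haar_zero_hrefl[OF M admissible_translate[OF f] that(1), of "hrefl w"]
    by eventually_elim simp
  have "AE V in M. \<forall>d\<in>D. fst d \<noteq> 0 \<and> snd d \<noteq> 0 \<longrightarrow> f V = 0 \<longrightarrow> f (hrefl (snd d) ** (hrefl (fst d) ** V)) = 0"
    unfolding AE_ball_countable[OF D(1)]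
  proof
    fix d assume "d \<in> D"
    show "AE V in M. fst d \<noteq> 0 \<and> snd d \<noteq> 0 \<longrightarrow> f V = 0 \<longrightarrow> f (hrefl (snd d) ** (hrefl (fst d) ** V)) = 0"
      using step[of "fst d" "snd d"] by (cases "fst d \<noteq> 0 \<and> snd d \<noteq> 0") auto
  qed
  with haar_AE_unitary[OF M] show ?thesis
  proof eventually_elim
    case (elim V)
    show ?case
    proof
      assume 0: "f V = 0"
      let ?X = "{d. fst d \<noteq> 0} \<inter> {d. snd d \<noteq> 0} \<inter> {d. f (hrefl (snd d) ** (hrefl (fst d) ** V)) \<noteq> 0}"
      have cont: "continuous_on UNIV f" using f by (simp add: admissible_def)
      have "continuous_on UNIV (\<lambda>d. f (hrefl (snd d) ** (hrefl (fst d) ** V)))"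
        by (rule continuous_on_compose2[OF cont])
          (auto intro!: continuous_intros simp: hrefl_def outer_def)
      then have "open ?X"
        by (intro open_Int open_Collect_neq continuous_intros)
      moreover have "?X \<noteq> {}"
      proof -
        obtain v w where "v \<noteq> 0" "w \<noteq> 0" "f (hrefl w ** (hrefl v ** V)) \<noteq> 0" using ex[OF elim(1)] by blast
        then have "(v, w) \<in> ?X" by simp
        then show ?thesis by blast
      qed
      ultimately obtain d where "d \<in> D" "d \<in> ?X" using D(2) by blast
      then show False using elim(2) 0 by auto
    qed
  qed
qed

text \<open>A Householder reflection along e - \<alpha> g works when \<alpha> g has the length of e
  and \<open>cip e (\<alpha> *s g)\<close> is real. The phase makes this product nonpositive, so e -
  \<alpha> g is nonzero even for parallel e and g.\<close>

lemma hrefl_carry: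
  assumes "e \<noteq> 0" "g \<noteq> 0"
  obtains \<alpha> c where "e - \<alpha> *s g \<noteq> 0" "c \<noteq> 0" "hrefl (e - \<alpha> *s g) *v e = c *s g"
proof -
  define z where "z = (if cip e g = 0 then 1 else cnj (sgn (cip e g)))"
  have z: "cnj z * z = 1" "z * cip e g = of_real (cmod (cip e g))"
  proof -
    have "cmod z = 1" by (simp add: z_def norm_sgn)
    then show "cnj z * z = 1" by (simp add: mult.commute[of "cnj z"] complex_norm_square[symmetric])
    show "z * cip e g = of_real (cmod (cip e g))"
    proof (cases "cip e g = 0")
      case False
      have "z * cip e g = of_real ((cmod (cip e g))\<^sup>2) / of_real (cmod (cip e g))"
        unfolding complex_norm_square using False by (simp add: z_def sgn_eq)
      then show ?thesis using False by (simp add: power2_eq_square)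
    qed simp
  qed
  define \<alpha> where "\<alpha> = - (of_real (norm e / norm g) * z)"
  define r where "r = norm e / norm g * cmod (cip e g)"
  have r: "\<alpha> * cip e g = - of_real r"
    using z(2) by (simp add: \<alpha>_def r_def mult.assoc)
  then have r': "cnj \<alpha> * cip g e = - of_real r"
    by (metis cnj_cip complex_cnj_complex_of_real complex_cnj_minus complex_cnj_mult)
  have "r \<ge> 0" by (simp add: r_def)
  have "cnj \<alpha> * \<alpha> * cip g g = of_real ((norm e)\<^sup>2) * (cnj z * z)"
    using assms by (simp add: \<alpha>_def cip_self power2_eq_square field_simps)
  then have \<alpha>: "cnj \<alpha> * \<alpha> * cip g g = of_real ((norm e)\<^sup>2)" using z by simp
  let ?v = "e - \<alpha> *s g"
  define s where "s = (norm e)\<^sup>2 + r"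
  have s: "s > 0" using assms \<open>r \<ge> 0\<close> by (simp add: s_def add_pos_nonneg)
  have ve: "cip ?v e = of_real s"
    using r' by (simp add: cip_simps cip_self s_def)
  have vv: "cip ?v ?v = 2 * of_real s"
    using r r' \<alpha> by (simp add: cip_simps cip_self[of e] s_def algebra_simps)
  have "?v \<noteq> 0"
  proof
    assume "?v = 0"
    then have "cip ?v ?v = 0" by simp
    then show False using s unfolding vv by simp
  qed
  moreover have "hrefl ?v *v e = (2 * of_real s * \<alpha>) *s g"
    unfolding hrefl_vector ve vv by (simp add: vec_eq_iff algebra_simps)
  moreover have "2 * of_real s * \<alpha> \<noteq> 0"
  proof -
    have "z \<noteq> 0" using z(1) by auto
    then show ?thesis using s assms by (simp add: \<alpha>_def)
  qed
  ultimately show ?thesis using that by blast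
qed

section \<open>Linear forms and the obstruction at a random unitary\<close>

lemma haar_AE_cip:
  assumes "haar M" "\<phi> \<noteq> 0" "a \<noteq> 0" shows "AE V in M. cip \<phi> (V *v a) \<noteq> 0"
proof (rule haar_AE_nonzero[OF assms(1)])
  show "admissible (\<lambda>V. cip \<phi> (V *v a))"
    unfolding admissible_def
  proof (intro conjI allI impI)
    show "continuous_on UNIV (\<lambda>V. cip \<phi> (V *v a))" by (intro continuous_intros)
    show "real_poly (\<lambda>u. cip \<phi> ((X + mscale (of_real u) Y) *v a))" for X Y
      unfolding cip_def by (intro real_poly_intros real_poly_matrix)
  qed (simp add: mscale_vector cip_simps)
next
  fix X assume X: "unitary_op X"
  have "X *v a \<noteq> 0" using unitary_norm[OF X, of a] assms(3) by auto
  then obtain \<alpha> c where c: "X *v a - \<alpha> *s \<phi> \<noteq> 0" "c \<noteq> 0" "hrefl (X *v a - \<alpha> *s \<phi>) *v (X *v a) = c *s \<phi>"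
    using hrefl_carry[OF _ assms(2)] by blast
  \<comment> \<open>The second reflection has nothing left to move; the one along \<phi> only
    rescales \<phi>.\<close>
  have "cip \<phi> (hrefl \<phi> *v (c *s \<phi>)) = - c * (cip \<phi> \<phi>)\<^sup>2"
    by (simp add: hrefl_vector cip_simps power2_eq_square algebra_simps)
  then have "cip \<phi> ((hrefl \<phi> ** (hrefl (X *v a - \<alpha> *s \<phi>) ** X)) *v a) \<noteq> 0"
    using c assms(2) by (simp add: matrix_vector_mul_assoc[symmetric] cip_simps)
  then show "\<exists>v w. v \<noteq> 0 \<and> w \<noteq> 0 \<and> cip \<phi> ((hrefl w ** (hrefl v ** X)) *v a) \<noteq> 0"
    using c(1) assms(2) by blast
qed

lemma obstr_nonzero_example:
  obtains g h where "g \<noteq> 0" "h \<noteq> 0" "cip g h = 0" "obstr g h \<noteq> 0"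
proof -
  \<comment> \<open>These have det2 g = 2 i, det2 h = 2 i - 1 and polar2 g h = -3, so obstr g h =
    -36 i.\<close>
  define g :: bvec where "g = (\<chi> p. if p = (0,0) then 1 else if p = (1,1) then 2 * \<i> else 0)"
  define h :: bvec where "h = (\<chi> p. if p = (0,0) then 2 * \<i> else 1)"
  have "g $ (0,0) \<noteq> 0" "h $ (0,0) \<noteq> 0" by (simp_all add: g_def h_def)
  then have "g \<noteq> 0" "h \<noteq> 0" by auto
  moreover have "cip g h = 0"
    unfolding cip_def sum_pair2 by (simp add: g_def h_def)
  moreover have "obstr g h \<noteq> 0"
    unfolding obstr_def det2_def polar2_def
    by (simp add: g_def h_def complex_eq_iff power2_eq_square)
  ultimately show ?thesis using that by blast
qed

text \<open>One reflection carries X a to the line of g. The image b' of X b is then orthogonal to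
  g, as is h, so the reflection carrying b' to the line of h only rescales g.\<close>

lemma haar_AE_obstr:
  assumes "haar M" "a \<noteq> 0" "b \<noteq> 0" "cip a b = 0"
  shows "AE V in M. obstr (V *v a) (V *v b) \<noteq> 0"
proof (rule haar_AE_nonzero[OF assms(1)])
  show "admissible (\<lambda>V. obstr (V *v a) (V *v b))"
    unfolding admissible_def
  proof (intro conjI allI impI)
    show "continuous_on UNIV (\<lambda>V. obstr (V *v a) (V *v b))" by (intro continuous_intros)
    show "real_poly (\<lambda>u. obstr ((X + mscale (of_real u) Y) *v a) ((X + mscale (of_real u) Y) *v b))" for X Y
      unfolding obstr_def det2_def polar2_def by (intro real_poly_intros real_poly_matrix)
  qed (simp add: mscale_vector obstr_scale)
next
  fix X assume X: "unitary_op X"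
  obtain g h where gh: "g \<noteq> 0" "h \<noteq> 0" "cip g h = 0" "obstr g h \<noteq> 0" by (rule obstr_nonzero_example)
  have "X *v a \<noteq> 0" using unitary_norm[OF X, of a] assms by auto
  then obtain \<alpha> c where c: "X *v a - \<alpha> *s g \<noteq> 0" "c \<noteq> 0" "hrefl (X *v a - \<alpha> *s g) *v (X *v a) = c *s g"
    using hrefl_carry[OF _ gh(1)] by blast
  define v where "v = X *v a - \<alpha> *s g"
  define b' where "b' = hrefl v *v (X *v b)"
  have v: "v \<noteq> 0" "hrefl v *v (X *v a) = c *s g" using c by (auto simp: v_def)
  have "X *v b \<noteq> 0" using unitary_norm[OF X, of b] assms by auto
  then have "cip b' b' \<noteq> 0" using v(1) unfolding b'_def cip_hrefl by simp
  then have "b' \<noteq> 0" by auto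
  then obtain \<beta> d where d: "b' - \<beta> *s h \<noteq> 0" "d \<noteq> 0" "hrefl (b' - \<beta> *s h) *v b' = d *s h"
    using hrefl_carry[OF _ gh(2)] by blast
  define w where "w = b' - \<beta> *s h"
  have "cip (hrefl v *v (X *v a)) b' = 0"
    unfolding b'_def cip_hrefl by (simp add: unitary_cip[OF X] assms(4))
  then have "cip g b' = 0" using c(2) unfolding v(2) by (simp add: cip_simps)
  then have "cip w g = 0" unfolding cip_commute_eq_0[of w] by (simp add: w_def cip_simps gh(3))
  then have "hrefl w *v (c *s g) = (cip w w * c) *s g"
    by (simp add: hrefl_vector cip_simps vec_eq_iff)
  moreover have "hrefl w *v b' = d *s h" using d by (simp add: w_def)
  moreover have w: "w \<noteq> 0" using d by (simp add: w_def)
  ultimately have "obstr ((hrefl w ** (hrefl v ** X)) *v a) ((hrefl w ** (hrefl v ** X)) *v b) \<noteq> 0"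
    using v c(2) d(2) gh(4)
    by (simp add: matrix_vector_mul_assoc[symmetric] b'_def[symmetric] obstr_scale)
  then show "\<exists>v w. v \<noteq> 0 \<and> w \<noteq> 0 \<and>
      obstr ((hrefl w ** (hrefl v ** X)) *v a) ((hrefl w ** (hrefl v ** X)) *v b) \<noteq> 0"
    using v(1) w by blast
qed

subsection \<open>Three Haar-random states\<close>

abbreviation states :: "(nat \<Rightarrow> real) \<Rightarrow> bop \<times> bop \<times> bop \<Rightarrow> nat \<Rightarrow> bvec" where
  "states p U \<equiv> weighted p (ensemble (fst U) (fst (snd U)) (snd (snd U)))"

definition act :: "bop \<Rightarrow> bop \<times> bop \<times> bop \<Rightarrow> bop \<times> bop \<times> bop" where
  "act V U = (V ** fst U, V ** fst (snd U), V ** snd (snd U))"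

lemma states_act: "states p (act V U) = (\<lambda>i. V *v states p U i)"
  by (simp add: fun_eq_iff act_def weighted_def ensemble_def matrix_vector_mul_assoc vector_scalar_commute)

lemma opt_frame_unitary:
  assumes V: "unitary_op V" and a: "opt_frame \<eta> a"
  shows "opt_frame (\<lambda>i. V *v \<eta> i) (\<lambda>i. V *v a i)"
proof -
  let ?l = "\<lambda>k::nat. min k 2"
  have "(cmod (cip (V *v \<eta> j) x))\<^sup>2 \<le> lag (\<lambda>i. V *v \<eta> i) 4 ?l (\<lambda>i. V *v a i) x" if "j < 3" for j x
  proof -
    have x: "x = V *v (madj V *v x)"
      by (simp add: matrix_vector_mul_assoc unitary_right_inverse[OF V])
    have "(cmod (cip (\<eta> j) (madj V *v x)))\<^sup>2 \<le> lag \<eta> 4 ?l a (madj V *v x)"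
      using a that by (simp add: opt_frame_def dual_feasible_def)
    then show ?thesis
      by (subst (1 2) x) (simp add: lag_def unitary_cip[OF V])
  qed
  then show ?thesis
    using a by (simp add: opt_frame_def orthonormal4_def dual_feasible_def unitary_cip[OF V])
qed

lemma indep3_unitary:
  assumes V: "unitary_op V" and "indep3 \<eta>"
  shows "indep3 (\<lambda>i. V *v \<eta> i)"
  unfolding indep3_def
proof (intro allI impI)
  fix x y assume xy: "(\<forall>i<3. cip (V *v \<eta> i) x = 0 \<and> cip (V *v \<eta> i) y = 0) \<and> cip x y = 0"
  have W: "unitary_op (madj V)" by (rule unitary_madj[OF V])
  have "cip (\<eta> i) (madj V *v z) = cip (V *v \<eta> i) z" for i z by (simp add: cip_adj)
  then have "madj V *v x = 0 \<or> madj V *v y = 0"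
    using assms(2) xy unfolding indep3_def by (metis unitary_cip[OF W])
  then show "x = 0 \<or> y = 0" using unitary_norm[OF W] by (metis norm_eq_zero)
qed

lemma opt_frame_cong:
  assumes "opt_frame \<eta> a" "\<And>i. i < 4 \<Longrightarrow> a i = c i" shows "opt_frame \<eta> c"
proof -
  have "lag \<eta> 4 (\<lambda>k. min k 2) a x = lag \<eta> 4 (\<lambda>k. min k 2) c x" for x
    unfolding lag_def using assms(2) by simp
  then show ?thesis
    using assms by (simp add: opt_frame_def orthonormal4_def dual_feasible_def)
qed

section \<open>Bad triples\<close>

definition bad :: "(nat \<Rightarrow> real) \<Rightarrow> (bop \<times> bop \<times> bop) set" where
  "bad p = {U. \<exists>a. opt_frame (states p U) a \<and> obstr (a 0) (a 3) = 0}"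

text \<open>Frames as quadruples, so that compactness of a finite product of balls is
  available.\<close>

definition frame4 :: "bvec \<times> bvec \<times> bvec \<times> bvec \<Rightarrow> nat \<Rightarrow> bvec" where
  "frame4 W i = (if i = 0 then fst W else if i = 1 then fst (snd W)
     else if i = 2 then fst (snd (snd W)) else snd (snd (snd W)))"

text \<open>\<open>bad\<close> is the projection of a closed set along the compact set of frames.\<close>

lemma closed_bad: "closed (bad p)"
proof -
  define K :: "(bvec \<times> bvec \<times> bvec \<times> bvec) set" where
    "K = cball 0 1 \<times> cball 0 1 \<times> cball 0 1 \<times> cball 0 1"
  define T where "T = {x. opt_frame (states p (snd x)) (frame4 (fst x)) \<and>
    obstr (frame4 (fst x) 0) (frame4 (fst x) 3) = 0}"
  have cf: "continuous_on UNIV (\<lambda>x. frame4 (fst x) i)" for i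
    by (cases "i = 0"; cases "i = 1"; cases "i = 2"; simp add: frame4_def; intro continuous_intros)
  have cs: "continuous_on UNIV (\<lambda>x. states p (snd x) i)" for i
    unfolding weighted_def ensemble_def vector_scalar_mult_def
    by (cases "i = 0"; cases "i = 1"; simp; intro continuous_intros)
  have cl: "continuous_on UNIV (\<lambda>x. lag (states p (snd x)) 4 (\<lambda>k. min k 2) (frame4 (fst x)) y)" for y
    unfolding lag_def by (intro continuous_intros cf cs)
  have "closed T"
    unfolding T_def opt_frame_def orthonormal4_def dual_feasible_def
    by (intro closed_Collect_conj closed_Collect_all closed_Collect_imp open_Collect_const
        closed_Collect_eq closed_Collect_le continuous_intros cf cs cl)
  moreover have "compact K" unfolding K_def by (intro compact_Times compact_cball)
  ultimately have "closed {U. \<exists>W. W \<in> K \<and> (W, U) \<in> T}"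
    by (intro closed_compact_projection)
  moreover have "{U. \<exists>W. W \<in> K \<and> (W, U) \<in> T} = bad p"
  proof (intro set_eqI iffI)
    fix U assume "U \<in> {U. \<exists>W. W \<in> K \<and> (W, U) \<in> T}"
    then show "U \<in> bad p" by (auto simp: T_def bad_def)
  next
    fix U assume "U \<in> bad p"
    then obtain a where a: "opt_frame (states p U) a" "obstr (a 0) (a 3) = 0"
      by (auto simp: bad_def)
    let ?W = "(a 0, a 1, a 2, a 3)"
    have W: "frame4 ?W i = a i" if "i < 4" for i
      using that by (auto simp: frame4_def less_4_cases)
    have "norm (a i) = 1" if "i < 4" for i
    proof -
      have "complex_of_real ((norm (a i))\<^sup>2) = 1"
        using a(1) that unfolding cip_self[symmetric] by (simp add: opt_frame_def orthonormal4_def)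
      then have "(norm (a i))\<^sup>2 = 1" by (simp del: of_real_power)
      then show ?thesis by (smt (verit) norm_ge_zero power2_eq_1_iff)
    qed
    then have K: "?W \<in> K" by (simp add: K_def)
    have "opt_frame (states p U) (frame4 ?W)"
      by (rule opt_frame_cong[OF a(1) W[symmetric]])
    moreover have "frame4 ?W 0 = a 0" "frame4 ?W 3 = a 3" by (simp_all add: frame4_def)
    ultimately have "(?W, U) \<in> T" using a(2) by (simp add: T_def)
    with K show "U \<in> {U. \<exists>W. W \<in> K \<and> (W, U) \<in> T}" by blast
  qed
  ultimately show ?thesis by simp
qed

text \<open>Either no unitary V makes the triple bad, or one that does hands over a frame, which is
  pulled back to U. In the second case uniqueness identifies the frames of every rotated triple up
  to scalars.\<close>

lemma AE_act_not_bad: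
  assumes M: "haar M" and ind: "indep3 (states p U)"
  shows "AE V in M. act V U \<notin> bad p"
proof (cases "\<exists>V. unitary_op V \<and> act V U \<in> bad p")
  case False
  then show ?thesis using haar_AE_unitary[OF M] by (auto elim: eventually_mono)
next
  case True
  then obtain V0 a0 where V0: "unitary_op V0" and a0: "opt_frame (states p (act V0 U)) a0"
    by (auto simp: bad_def)
  define a where "a i = madj V0 *v a0 i" for i
  have "madj V0 *v (V0 *v x) = x" for x
    using V0 by (simp add: matrix_vector_mul_assoc unitary_op_def)
  then have a: "opt_frame (states p U) a"
    using opt_frame_unitary[OF unitary_madj[OF V0] a0] by (simp add: states_act a_def[abs_def])
  then have o: "cip (a i) (a j) = (if i = j then 1 else 0)" if "i < 4" "j < 4" for i j
    using that by (simp add: opt_frame_def orthonormal4_def)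
  have "a 0 \<noteq> 0" "a 3 \<noteq> 0" "cip (a 0) (a 3) = 0" using o[of 0 0] o[of 3 3] o[of 0 3] by auto
  then have "AE V in M. obstr (V *v a 0) (V *v a 3) \<noteq> 0" by (rule haar_AE_obstr[OF M])
  with haar_AE_unitary[OF M] show ?thesis
  proof eventually_elim
    case (elim V)
    show ?case
    proof
      assume "act V U \<in> bad p"
      then obtain c where c: "opt_frame (states p (act V U)) c" "obstr (c 0) (c 3) = 0"
        by (auto simp: bad_def)
      have f: "opt_frame (states p (act V U)) (\<lambda>i. V *v a i)"
        unfolding states_act by (rule opt_frame_unitary[OF elim(1) a])
      have i: "indep3 (states p (act V U))"
        unfolding states_act by (rule indep3_unitary[OF elim(1) ind])
      obtain \<alpha> \<beta> where \<alpha>: "c 0 = \<alpha> *s (V *v a 0)" and \<beta>: "c 3 = \<beta> *s (V *v a 3)"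
        by (rule opt_frame_unique[OF i f c(1)]) (rule that)
      have "cip (c 0) (c 0) = 1" "cip (c 3) (c 3) = 1"
        using c(1) by (auto simp: opt_frame_def orthonormal4_def)
      then have "\<alpha> \<noteq> 0" "\<beta> \<noteq> 0" unfolding \<alpha> \<beta> by (auto simp: cip_simps)
      then show False using c(2) elim(2) unfolding \<alpha> \<beta> obstr_scale by simp
    qed
  qed
qed

section \<open>Almost sure linear independence\<close>

definition minor3 :: "bvec \<Rightarrow> bvec \<Rightarrow> bvec \<Rightarrow> complex" where
  "minor3 u v w =
     (u $ (0,1) * v $ (1,0) - u $ (1,0) * v $ (0,1)) * w $ (0,0)
   - (u $ (0,0) * v $ (1,0) - u $ (1,0) * v $ (0,0)) * w $ (0,1)
   + (u $ (0,0) * v $ (0,1) - u $ (0,1) * v $ (0,0)) * w $ (1,0)"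

lemma minor3_orthogonal:
  assumes "minor3 u v w \<noteq> 0" "cip u x = 0" "cip v x = 0" "cip w x = 0" "x $ (1,1) = 0"
  shows "x = 0"
proof -
  have e: "cnj (u $ (0,0)) * x $ (0,0) + cnj (u $ (0,1)) * x $ (0,1) + cnj (u $ (1,0)) * x $ (1,0) = 0"
    "cnj (v $ (0,0)) * x $ (0,0) + cnj (v $ (0,1)) * x $ (0,1) + cnj (v $ (1,0)) * x $ (1,0) = 0"
    "cnj (w $ (0,0)) * x $ (0,0) + cnj (w $ (0,1)) * x $ (0,1) + cnj (w $ (1,0)) * x $ (1,0) = 0"
    using assms by (simp_all add: cip_def sum_pair2)
  have "cnj (minor3 u v w) * x $ (0,0) = 0" "cnj (minor3 u v w) * x $ (0,1) = 0"
    "cnj (minor3 u v w) * x $ (1,0) = 0"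
    unfolding minor3_def complex_cnj_add complex_cnj_diff complex_cnj_mult using e by algebra+
  then have "\<forall>p. x $ p = 0" unfolding forall_pair2 using assms(1,5) by simp
  then show ?thesis by (simp add: vec_eq_iff)
qed

text \<open>The combination of x and y with vanishing coordinate (1,1) is 0. Pairing it with x,
  which is orthogonal to y, leaves x = 0 or y $ (1,1) = 0, and the latter gives y = 0.\<close>

lemma indep3_minor:
  assumes "minor3 (\<eta> 0) (\<eta> 1) (\<eta> 2) \<noteq> 0" shows "indep3 \<eta>"
  unfolding indep3_def
proof (intro allI impI)
  fix x y assume xy: "(\<forall>i<3. cip (\<eta> i) x = 0 \<and> cip (\<eta> i) y = 0) \<and> cip x y = 0"
  have z: "z = 0" if "\<And>i. i < 3 \<Longrightarrow> cip (\<eta> i) z = 0" "z $ (1,1) = 0" for z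
    using minor3_orthogonal[OF assms] that by simp
  have "y $ (1,1) *s x - x $ (1,1) *s y = 0"
    using xy by (intro z) (auto simp: cip_simps)
  then have "cip x (y $ (1,1) *s x) = cip x (x $ (1,1) *s y)" by simp
  then have "y $ (1,1) = 0 \<or> x = 0" using xy by (simp add: cip_simps)
  then show "x = 0 \<or> y = 0" using z[of y] xy by blast
qed

lemma indep3_weighted:
  assumes "indep3 \<psi>" "\<forall>i<3. 0 < p i" shows "indep3 (weighted p \<psi>)"
proof -
  have "cip (weighted p \<psi> i) x = 0 \<longleftrightarrow> cip (\<psi> i) x = 0" if "i < 3" for i x
    using assms(2) that by (auto simp: weighted_def cip_simps)
  then show ?thesis using assms(1) unfolding indep3_def by simp
qed

lemma sets_haar_prod:
  assumes "haar M"
  shows "sets (M \<Otimes>\<^sub>M M) = sets (borel :: (bop \<times> bop) measure)"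
    and "sets (M \<Otimes>\<^sub>M (M \<Otimes>\<^sub>M M)) = sets (borel :: (bop \<times> bop \<times> bop) measure)"
proof -
  show 2: "sets (M \<Otimes>\<^sub>M M) = sets (borel :: (bop \<times> bop) measure)"
    unfolding borel_prod[symmetric] by (intro sets_pair_measure_cong haar_prob assms)
  show "sets (M \<Otimes>\<^sub>M (M \<Otimes>\<^sub>M M)) = sets (borel :: (bop \<times> bop \<times> bop) measure)"
    unfolding borel_prod[symmetric, where 'a=bop and 'b="bop \<times> bop"]
    by (intro sets_pair_measure_cong haar_prob assms 2)
qed

lemma continuous_on_minor3 [continuous_intros]:
  assumes "continuous_on S f" "continuous_on S g" "continuous_on S h"
  shows "continuous_on S (\<lambda>x. minor3 (f x) (g x) (h x))"
  unfolding minor3_def by (intro continuous_intros assms)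

text \<open>The leading minors of sizes 1, 2 and 3 are treated in turn. Each is a linear form in the
  newest vector, with a coefficient equal, up to conjugation, to the previous minor, so
  \<open>haar_AE_cip\<close> applies.\<close>

lemma AE_minor3:
  assumes M: "haar M"
  shows "AE U in M \<Otimes>\<^sub>M (M \<Otimes>\<^sub>M M).
    minor3 (fst U *v ket00) (fst (snd U) *v ket00) (snd (snd U) *v ket00) \<noteq> 0"
proof -
  interpret M: sigma_finite_measure M by (rule haar_prob[OF M])
  interpret P: pair_sigma_finite M M by unfold_locales
  interpret Q: pair_sigma_finite M "M \<Otimes>\<^sub>M M" by unfold_locales
  note sp = sets_haar_prod[OF M]
  have k: "ket00 \<noteq> 0"
  proof
    assume "ket00 = 0"
    then have "ket00 $ (0,0) = 0" by simp
    then show False by (simp add: ket00_def)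
  qed
  define \<phi>1 :: bvec where "\<phi>1 = (\<chi> q. if q = (0,0) then 1 else 0)"
  define \<phi>2 :: "bvec \<Rightarrow> bvec" where "\<phi>2 u = (\<chi> q. if q = (0,0) then - cnj (u $ (0,1))
    else if q = (0,1) then cnj (u $ (0,0)) else 0)" for u
  define \<phi>3 :: "bvec \<Rightarrow> bvec \<Rightarrow> bvec" where "\<phi>3 u v = (\<chi> q.
    if q = (0,0) then cnj (u $ (0,1) * v $ (1,0) - u $ (1,0) * v $ (0,1))
    else if q = (0,1) then - cnj (u $ (0,0) * v $ (1,0) - u $ (1,0) * v $ (0,0))
    else if q = (1,0) then cnj (u $ (0,0) * v $ (0,1) - u $ (0,1) * v $ (0,0)) else 0)" for u v
  have c1: "cip \<phi>1 u = u $ (0,0)" for u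
    unfolding cip_def sum_pair2 by (simp add: \<phi>1_def)
  have c2: "cip (\<phi>2 u) v = u $ (0,0) * v $ (0,1) - u $ (0,1) * v $ (0,0)" for u v
    unfolding cip_def sum_pair2 by (simp add: \<phi>2_def)
  have c3: "cip (\<phi>3 u v) w = minor3 u v w" for u v w
    unfolding cip_def sum_pair2 minor3_def by (simp add: \<phi>3_def algebra_simps)
  have n1: "\<phi>1 \<noteq> 0" using c1[of \<phi>1] by (auto simp: \<phi>1_def)
  have n2: "\<phi>2 u \<noteq> 0" if "cip \<phi>1 u \<noteq> 0" for u
  proof
    assume "\<phi>2 u = 0"
    then have "\<phi>2 u $ (0,1) = 0" by simp
    then show False using that by (simp add: \<phi>2_def c1)
  qed
  have n3: "\<phi>3 u v \<noteq> 0" if "cip (\<phi>2 u) v \<noteq> 0" for u v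
  proof
    assume "\<phi>3 u v = 0"
    moreover have "\<phi>3 u v $ (1,0) = cnj (cip (\<phi>2 u) v)" unfolding c2 by (simp add: \<phi>3_def)
    ultimately show False using that by (simp add: cip_commute_eq_0[of v])
  qed
  let ?P = "\<lambda>U :: bop \<times> bop \<times> bop. minor3 (fst U *v ket00) (fst (snd U) *v ket00) (snd (snd U) *v ket00) \<noteq> 0"
  have "AE A in M. AE Y in M \<Otimes>\<^sub>M M. ?P (A, Y)"
    using haar_AE_cip[OF M n1 k]
  proof eventually_elim
    case (elim A)
    have "AE B in M. AE C in M. ?P (A, B, C)"
      using haar_AE_cip[OF M n2[OF elim] k]
    proof eventually_elim
      case (elim B)
      show ?case using haar_AE_cip[OF M n3[OF elim] k] by (simp add: c3)
    qed
    moreover have "open {Y. ?P (A, Y)}"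
      by (simp, intro open_Collect_neq continuous_intros)
    then have "{Y \<in> space (M \<Otimes>\<^sub>M M). ?P (A, Y)} \<in> sets (M \<Otimes>\<^sub>M M)"
      using sp(1) sets_eq_imp_space_eq[OF sp(1)] by simp
    ultimately show ?case by (intro P.AE_pair_measure)
  qed
  moreover have "open {U. ?P U}" by (intro open_Collect_neq continuous_intros)
  then have "{U \<in> space (M \<Otimes>\<^sub>M (M \<Otimes>\<^sub>M M)). ?P U} \<in> sets (M \<Otimes>\<^sub>M (M \<Otimes>\<^sub>M M))"
    using sp(2) sets_eq_imp_space_eq[OF sp(2)] by simp
  ultimately show ?thesis by (intro Q.AE_pair_measure)
qed

section \<open>Averaging over a common rotation\<close>

lemma distr_act:
  assumes M: "haar M" and V: "unitary_op V"
  shows "act V \<in> measurable (M \<Otimes>\<^sub>M (M \<Otimes>\<^sub>M M)) (M \<Otimes>\<^sub>M (M \<Otimes>\<^sub>M M))"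
    and "distr (M \<Otimes>\<^sub>M (M \<Otimes>\<^sub>M M)) (M \<Otimes>\<^sub>M (M \<Otimes>\<^sub>M M)) (act V) = M \<Otimes>\<^sub>M (M \<Otimes>\<^sub>M M)"
proof -
  interpret M: sigma_finite_measure M by (rule haar_prob[OF M])
  interpret P: pair_sigma_finite M M by unfold_locales
  note hp = haar_prob[OF M]
  let ?f = "\<lambda>U. V ** U"
  let ?g = "\<lambda>(x, y). (?f x, ?f y)"
  have act: "act V = (\<lambda>(x, y). (?f x, ?g y))" by (auto simp: act_def fun_eq_iff)
  have "continuous_on UNIV ?f" by (intro continuous_intros)
  then have f: "?f \<in> measurable M M"
    using borel_measurable_continuous_onI measurable_cong_sets[OF hp(5) hp(5)] by blast
  then have g: "?g \<in> measurable (M \<Otimes>\<^sub>M M) (M \<Otimes>\<^sub>M M)" by measurable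
  then show "act V \<in> measurable (M \<Otimes>\<^sub>M (M \<Otimes>\<^sub>M M)) (M \<Otimes>\<^sub>M (M \<Otimes>\<^sub>M M))"
    unfolding act case_prod_beta'
    by (intro measurable_Pair measurable_compose[OF measurable_fst f]
        measurable_compose[OF measurable_snd g[unfolded case_prod_beta']])
  have df: "distr M M ?f = M"
  proof (rule measure_eqI)
    fix A assume "A \<in> sets (distr M M ?f)"
    then have "A \<in> sets M" by simp
    then show "emeasure (distr M M ?f) A = emeasure M A"
      using M V hp(4,5) by (simp add: emeasure_distr[OF f] haar_def)
  qed simp
  have dg: "distr (M \<Otimes>\<^sub>M M) (M \<Otimes>\<^sub>M M) ?g = M \<Otimes>\<^sub>M M"
    using pair_measure_distr[OF f f] df M.sigma_finite_measure_axioms by simp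
  show "distr (M \<Otimes>\<^sub>M (M \<Otimes>\<^sub>M M)) (M \<Otimes>\<^sub>M (M \<Otimes>\<^sub>M M)) (act V) = M \<Otimes>\<^sub>M (M \<Otimes>\<^sub>M M)"
    unfolding act using pair_measure_distr[OF f g] df dg P.sigma_finite_measure_axioms by simp
qed

text \<open>Almost every V turns almost every triple into a good one. Fubini exchanges the
  quantifiers, a single unitary V is fixed, and the joint law is invariant under
  \<open>act V\<close>.\<close>

lemma AE_not_bad:
  assumes M: "haar M" and p: "\<forall>i<3. 0 < p i"
  shows "AE U in M \<Otimes>\<^sub>M (M \<Otimes>\<^sub>M M). indep3 (states p U) \<and> U \<notin> bad p"
proof -
  let ?M3 = "M \<Otimes>\<^sub>M (M \<Otimes>\<^sub>M M)"
  interpret M: sigma_finite_measure M by (rule haar_prob[OF M])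
  interpret P: pair_sigma_finite M M by unfold_locales
  interpret Q: pair_sigma_finite M "M \<Otimes>\<^sub>M M" by unfold_locales
  interpret R: pair_sigma_finite ?M3 M by unfold_locales
  note hp = haar_prob[OF M]
  note sp = sets_haar_prod(2)[OF M]
  have ind: "AE U in ?M3. indep3 (states p U)"
    using AE_minor3[OF M]
  proof eventually_elim
    case (elim U)
    show ?case by (rule indep3_weighted[OF indep3_minor p]) (use elim in \<open>simp add: ensemble_def\<close>)
  qed
  have s4: "sets (?M3 \<Otimes>\<^sub>M M) = sets (borel :: ((bop \<times> bop \<times> bop) \<times> bop) measure)"
    unfolding borel_prod[symmetric, where 'a="bop \<times> bop \<times> bop" and 'b=bop]
    by (intro sets_pair_measure_cong sp hp)
  have "continuous_on UNIV (\<lambda>x. act (snd x) (fst x))"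
    unfolding act_def by (intro continuous_intros)
  then have "open ((\<lambda>x. act (snd x) (fst x)) -` (- bad p))"
    using closed_bad[of p] by (intro open_vimage) auto
  moreover have "{x \<in> space (?M3 \<Otimes>\<^sub>M M). act (snd x) (fst x) \<notin> bad p} =
      (\<lambda>x. act (snd x) (fst x)) -` (- bad p)"
    using sets_eq_imp_space_eq[OF s4] by auto
  ultimately have meas: "{x \<in> space (?M3 \<Otimes>\<^sub>M M). act (snd x) (fst x) \<notin> bad p} \<in> sets (?M3 \<Otimes>\<^sub>M M)"
    unfolding s4 by simp
  have "AE U in ?M3. AE V in M. act V U \<notin> bad p"
    using ind by eventually_elim (rule AE_act_not_bad[OF M])
  then have "AE V in M. AE U in ?M3. act V U \<notin> bad p"
    using R.AE_commute[OF meas] by simp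
  with haar_AE_unitary[OF M] have both: "AE V in M. unitary_op V \<and> (AE U in ?M3. act V U \<notin> bad p)"
    by eventually_elim simp
  \<comment> \<open>The total mass is 1, so a property that holds almost everywhere has a
    witness.\<close>
  have "\<exists>V. unitary_op V \<and> (AE U in ?M3. act V U \<notin> bad p)"
  proof (rule ccontr)
    assume "\<not> ?thesis"
    with both have "AE V in M. False" by (auto elim: eventually_mono simp del: AE_conj_iff eventually_conj_iff)
    then show False using hp(3,4) by (simp add: eventually_False ae_filter_eq_bot_iff)
  qed
  then obtain V where V: "unitary_op V" "AE U in ?M3. act V U \<notin> bad p" by auto
  have "{U \<in> space ?M3. U \<notin> bad p} \<in> sets ?M3"
    using closed_bad[of p] sp sets_eq_imp_space_eq[OF sp] by (simp add: Collect_neg_eq)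
  then have "AE U in distr ?M3 ?M3 (act V). U \<notin> bad p"
    using V(2) distr_act(1)[OF M V(1)] by (subst AE_distr_iff)
  then have "AE U in ?M3. U \<notin> bad p" unfolding distr_act(2)[OF M V(1)] .
  with ind show ?thesis by eventually_elim simp
qed

theorem theorem1:
  fixes p :: "nat \<Rightarrow> real" and M :: "bop measure"
  assumes "\<forall>i<3. 0 < p i" and "p 0 + p 1 + p 2 = 1" and "haar M"
  shows "AE U in M \<Otimes>\<^sub>M (M \<Otimes>\<^sub>M M).
           \<not> (\<exists>P. locc_povm 3 P \<and>
                 succ_prob 3 p (ensemble (fst U) (fst (snd U)) (snd (snd U))) P
                 = opt_succ 3 p (ensemble (fst U) (fst (snd U)) (snd (snd U))))"
  using AE_not_bad[OF assms(3,1)]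
proof eventually_elim
  case (elim U)
  show ?case
  proof
    assume "\<exists>P. locc_povm 3 P \<and>
                 succ_prob 3 p (ensemble (fst U) (fst (snd U)) (snd (snd U))) P
                 = opt_succ 3 p (ensemble (fst U) (fst (snd U)) (snd (snd U)))"
    then obtain P where P: "locc_povm 3 P" "succ_prob 3 p (ensemble (fst U) (fst (snd U)) (snd (snd U))) P
        = opt_succ 3 p (ensemble (fst U) (fst (snd U)) (snd (snd U)))" by auto
    have ind: "indep3 (states p U)" using elim by blast
    obtain a where "opt_frame (states p U) a" "obstr (a 0) (a 3) = 0"
      by (rule locc_optimal_frame[OF assms(1) ind P]) (rule that)
    then show False using elim by (auto simp: bad_def)
  qed
qed

end
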